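(* Let $\varepsilon\in[0,1]$ and $R\ge 0$. Let $X$ be uniformly distributed on $\mathbf{F}_2$ and let $Z$ be the output of the binary erasure channel with erasure probability $\varepsilon$ with input $X$. Then there exists a sequence of linear functions $f_n:\mathbf{F}_2^n\to\mathbf{F}_2^{k_n}$, $f_n(x^n)=x^nM_n^T$, where $M_n$ is a $k_n\times n$ matrix over $\mathbf{F}_2$ and $\liminf_{n\to\infty}\frac{k_n}{n}\log 2\ge R$, such that, with $\mathcal{C}_n$ the linear code whose generator matrix is $M_n$, $$E(R;X|Z)\ \ge\ \liminf_{n\to\infty}-\frac1n\log I(f_n)\ \ge\ \liminf_{n\to\infty}-\frac1n\log P_{ML}(\mathcal{C}_n,1-\varepsilon)\ \ge\ E_x(R,1-\varepsilon),$$ where $$E_x(R,1-\varepsilon):=\max_{\theta\ge 1}\Big[\theta\big\{\log 2-R-\log\big(1+(1-\varepsilon)^{1/\theta}\big)\big\}\Big].$$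
   Context: All logarithms are natural. $\mathbf{F}_2$ is the field with two elements; sequences are row vectors. The maximum over $\theta\ge1$ is understood as a supremum in the extended reals, and $-\log 0=+\infty$. Binary erasure channel BEC($\delta$): input alphabet $\mathbf{F}_2$, output alphabet $\mathbf{F}_2\cup\{?\}$; it outputs the input with probability $1-\delta$ and $?$ with probability $\delta$. Hence $P_{XZ}(x,x)=\frac{1-\varepsilon}{2}$, $P_{XZ}(x,?)=\frac{\varepsilon}{2}$ for $x\in\mathbf{F}_2$. $(X^n,Z^n)$ denotes $n$ i.i.d. copies of $(X,Z)$. For a function $f_n:\mathcal{X}^n\to\mathcal{S}_n$ into a finite set $\mathcal{S}_n$ (here $\mathcal{X}=\mathbf{F}_2$), put $S_n=f_n(X^n)$ and let $I(f_n)=I(S_n;Z^n)$ be the mutual information (the leaked information). For $R\ge0$, $$E(R;X|Z)=\sup\Big\{\liminf_{n\to\infty}-\frac1n\log I(f_n)\ :\ \liminf_{n\to\infty}\frac1n\log|\mathcal{S}_n|\ge R\Big\},$$ the supremum being over all sequences of (not necessarily linear) functions $f_n:\mathcal{X}^n\to\mathcal{S}_n$ satisfying the rate constraint. $P_{ML}(\mathcal{C}_n,1-\varepsilon)$ is the maximum likelihood decoding error probability of $\mathcal{C}_n$ over memoryless BEC($1-\varepsilon$) (erasure probability $1-\varepsilon$): a message $m\in\mathbf{F}_2^{k_n}$ is encoded as $mM_n$ and sent over $n$ independent uses of the channel; the decoder outputs the message maximizing the likelihood of the received word, and an error occurs whenever the maximizer is not unique (ties count as errors) or is not the transmitted message (this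 probability does not depend on the message). *)

theory Defs
  imports
    "HOL-Probability.Probability"
    "HOL-Library.Z2"
    "Jordan_Normal_Form.Matrix"
begin

hide_type (open) Finite_Cartesian_Product.vec
hide_const (open) Finite_Cartesian_Product.vec

(* The two-element field is the type bit. Sequences of length n over an alphabet are the elements
   of carrier_vec n. Vectors of Jordan_Normal_Form carry no row/column orientation, so the row
   vector products x M^T and m M are written M *\<^sub>v x and M\<^sup>T *\<^sub>v m. *)

definition bec :: "real \<Rightarrow> bit \<Rightarrow> bit option pmf" where
  "bec \<delta> x = map_pmf (\<lambda>erased. if erased then None else Some x) (bernoulli_pmf \<delta>)"

definition bec_joint :: "real \<Rightarrow> (bit \<times> bit option) pmf" where
  "bec_joint \<delta> =
     do { x \<leftarrow> pmf_of_set {0, 1}; z \<leftarrow> bec \<delta> x; return_pmf (x, z) }"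

(* n independent uses of the channel, for the input word x of length n *)
definition bec_word :: "real \<Rightarrow> bit vec \<Rightarrow> bit option vec pmf" where
  "bec_word \<delta> x =
     map_pmf (vec (dim_vec x)) (Pi_pmf {..<dim_vec x} undefined (\<lambda>i. bec \<delta> (x $ i)))"

(* joint law of (X^n, Z^n) for n i.i.d. copies of a pair (X, Z) with law P *)
definition iid_pair :: "nat \<Rightarrow> ('x \<times> 'z) pmf \<Rightarrow> ('x vec \<times> 'z vec) pmf" where
  "iid_pair n P =
     map_pmf (\<lambda>w. (vec n (fst \<circ> w), vec n (snd \<circ> w))) (Pi_pmf {..<n} undefined (\<lambda>_. P))"

(* I(f(X^n); Z^n) in nats. The counting measures on UNIV are adequate because all the alphabets
   (and hence all the types of finite words) involved are countable. *)
definition leaked_information ::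
    "('x \<times> 'z) pmf \<Rightarrow> nat \<Rightarrow> ('x vec \<Rightarrow> 's) \<Rightarrow> real" where
  "leaked_information P n f =
     prob_space.mutual_information (measure_pmf (iid_pair n P)) (exp 1)
       (count_space UNIV) (count_space UNIV) (\<lambda>(x, z). f x) (\<lambda>(x, z). z)"

(* ln 0 = 0 in HOL, whereas the convention here is - log 0 = \<infinity> *)
definition neg_log :: "real \<Rightarrow> ereal" where
  "neg_log t = (if t = 0 then \<infinity> else ereal (- ln t))"

definition exponent :: "(nat \<Rightarrow> real) \<Rightarrow> ereal" where
  "exponent a = liminf (\<lambda>n. ereal (1 / real n) * neg_log (a n))"

(* Every finite set is in bijection with a finite set of natural numbers and the leaked
   information is invariant under relabelling the values of f n, so it is no restriction to let
   the finite ranges S n be sets of natural numbers. *)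
definition privacy_exponent :: "real \<Rightarrow> ('x \<times> 'z) pmf \<Rightarrow> ereal" where
  "privacy_exponent R P =
     Sup {exponent (\<lambda>n. leaked_information P n (f n)) | f (S :: nat \<Rightarrow> nat set).
            (\<forall>n. finite (S n) \<and> f n \<in> carrier_vec n \<rightarrow> S n) \<and>
            liminf (\<lambda>n. ereal (1 / real n * ln (real (card (S n))))) \<ge> ereal R}"

(* the messages whose codewords maximize the likelihood of the received word z *)
definition ml_messages :: "bit mat \<Rightarrow> real \<Rightarrow> bit option vec \<Rightarrow> bit vec set" where
  "ml_messages M \<delta> z =
     {m. is_arg_max (\<lambda>m. pmf (bec_word \<delta> (M\<^sup>T *\<^sub>v m)) z)
           (\<lambda>m. m \<in> carrier_vec (dim_row M)) m}"

(* Error probability of maximum likelihood decoding over the erasure channel for the encoder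
   given by the generator matrix M; the transmitted message is uniformly distributed, which is
   immaterial because by linearity the error probability is the same for every message. *)
definition ml_error_prob :: "bit mat \<Rightarrow> real \<Rightarrow> real" where
  "ml_error_prob M \<delta> =
     measure_pmf.prob
       (do { m \<leftarrow> pmf_of_set (carrier_vec (dim_row M));
             z \<leftarrow> bec_word \<delta> (M\<^sup>T *\<^sub>v m);
             return_pmf (m, z) })
       {(m, z). ml_messages M \<delta> z \<noteq> {m}}"

definition expurgated_exponent :: "real \<Rightarrow> real \<Rightarrow> ereal" where
  "expurgated_exponent R \<delta> =
     (SUP \<theta>\<in>{1..}. ereal (\<theta> * (ln 2 - R - ln (1 + \<delta> powr (1 / \<theta>)))))"

end

theory Submission
  imports Defs "HOL-Real_Asymp.Real_Asymp"
begin

text \<open>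
  Call a set \<open>E\<close> of positions ambiguous for \<open>M\<close> if a nonzero message has a codeword vanishing on \<open>E\<close>.
  Decoding fails exactly when the set of unerased positions is ambiguous, and over the channel with
  erasure probability \<open>1 - \<epsilon>\<close> this set has the law of the set erased by the eavesdropper's channel.
  If the latter is not ambiguous, a character sum shows that \<open>M x\<close> remains uniform given \<open>Z\<close>, so only
  ambiguous erasure sets leak, each at most \<open>n ln 2\<close>; hence \<open>I \<le> n ln 2 P\<^sub>M\<^sub>L\<close>.

  For the error exponent, the union bound and the subadditivity of \<open>t \<mapsto> t\<^bsup>1/\<theta>\<^esup>\<close> bound
  \<open>P\<^sub>M\<^sub>L\<^bsup>1/\<theta>\<^esup>\<close> by the sum of \<open>d\<^bsup>w\<^esup>\<close> over the weights \<open>w\<close> of the codewords of nonzero messages,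
  where \<open>d = \<delta>\<^bsup>1/\<theta>\<^esup>\<close>. Its average over all matrices is at most \<open>2\<^bsup>k\<^esup> ((1 + d) / 2)\<^bsup>n\<^esup>\<close>. A matrix of
  least error probability satisfies the resulting bound for all \<open>\<theta>\<close> at once, without expurgation.
\<close>

no_notation Inner_Product.real_inner_class.inner (infix "\<bullet>" 70)
no_notation Finite_Cartesian_Product.vec_nth (infixl "$" 90)

section \<open>Arithmetic modulo two and finiteness of the sets of words and matrices\<close>

lemma UNIV_bit: "(UNIV :: bit set) = {0, 1}"
  using bit_not_zero_iff by blast

lemma finite_UNIV_bit [simp]: "finite (UNIV :: bit set)"
  by (simp add: UNIV_bit)

lemma bit_add_eq_0_iff: "a + b = 0 \<longleftrightarrow> a = b" for a b :: bit
  by (cases a; cases b) auto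

lemma bit_add_self [simp]: "a + a = 0" for a :: bit
  by (simp add: bit_add_eq_0_iff)

lemma countable_UNIV_bit_option: "countable (UNIV :: bit option set)"
  by (rule countable_finite) simp

lemma countable_vec: "countable (UNIV :: 'a set) \<Longrightarrow> countable (UNIV :: 'a vec set)"
proof -
  assume "countable (UNIV :: 'a set)"
  then have "countable (lists (UNIV :: 'a set))" by (rule countable_lists)
  then have "countable (vec_of_list ` (UNIV :: 'a list set))" by simp
  moreover have "range (vec_of_list :: 'a list \<Rightarrow> 'a vec) = UNIV"
    by (metis surjI vec_list)
  ultimately show ?thesis by simp
qed

text \<open>Transports cardinalities and sums from extensional functions, where product rules apply,
  to words. The choice \<open>A = UNIV\<close> gives all of \<open>carrier_vec n\<close>.\<close>

lemma bij_betw_vec_PiE: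
  "bij_betw (vec n) (Pi\<^sub>E {..<n} (\<lambda>_. A)) {v \<in> carrier_vec n. \<forall>i<n. v $ i \<in> A}"
proof (rule bij_betw_byWitness[where f' = "\<lambda>v. restrict (($) v) {..<n}"])
qed (auto simp: PiE_def extensional_def restrict_def fun_eq_iff)

lemma finite_carrier_vec_finite:
  "finite (UNIV :: 'a set) \<Longrightarrow> finite (carrier_vec n :: 'a vec set)"
  using bij_betw_finite[OF bij_betw_vec_PiE[of n "UNIV :: 'a set"]]
  by (simp add: finite_PiE)

lemma card_carrier_vec:
  "card (carrier_vec n :: 'a vec set) = CARD('a) ^ n"
  using bij_betw_same_card[OF bij_betw_vec_PiE[of n "UNIV :: 'a set"]]
  by (simp add: card_PiE)

lemma finite_carrier_vec_bit [simp]: "finite (carrier_vec n :: bit vec set)"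
  by (simp add: finite_carrier_vec_finite)

lemma card_carrier_vec_bit [simp]: "card (carrier_vec n :: bit vec set) = 2 ^ n"
  by (simp add: card_carrier_vec UNIV_bit numeral_2_eq_2)

lemma carrier_vec_nonempty [simp]: "carrier_vec n \<noteq> ({} :: 'a vec set)"
  using vec_carrier[of n "\<lambda>_. undefined"] by blast

lemma finite_carrier_mat_bit [simp]: "finite (carrier_mat r c :: bit mat set)"
proof (rule finite_imageD)
  \<comment> \<open>A matrix is encoded by the word of its rows, which has length \<open>r\<close>
    over the finite alphabet \<open>carrier_vec c\<close>.\<close>
  show "inj_on (\<lambda>A. vec r (row A)) (carrier_mat r c :: bit mat set)"
  proof (rule inj_onI)
    fix A B :: "bit mat"
    assume A: "A \<in> carrier_mat r c" and B: "B \<in> carrier_mat r c"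
      and eq: "vec r (row A) = vec r (row B)"
    have "row A i = row B i" if "i < r" for i
      using arg_cong[OF eq, of "\<lambda>v. v $ i"] that by simp
    then show "A = B"
      using A B by (intro eq_rowI) (metis carrier_matD(1), metis carrier_matD, metis carrier_matD)
  qed
  have "(\<lambda>A. vec r (row A)) ` (carrier_mat r c :: bit mat set) \<subseteq>
      {v \<in> carrier_vec r. \<forall>i<r. v $ i \<in> carrier_vec c}"
    by auto
  moreover have "finite {v \<in> carrier_vec r. \<forall>i<r. v $ i \<in> (carrier_vec c :: bit vec set)}"
    using bij_betw_finite[OF bij_betw_vec_PiE[of r "carrier_vec c :: bit vec set"]]
    by (simp add: finite_PiE)
  ultimately show "finite ((\<lambda>A. vec r (row A)) ` (carrier_mat r c :: bit mat set))"
    using finite_subset by blast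
qed

lemma carrier_mat_nonempty [simp]: "carrier_mat r c \<noteq> ({} :: 'a mat set)"
  using mat_carrier[of r c "\<lambda>_. undefined"] by blast

lemma vec_bit_add_self [simp]: "v \<in> carrier_vec n \<Longrightarrow> v + v = 0\<^sub>v n" for v :: "bit vec"
  by (intro eq_vecI) auto

lemma vec_bit_add_eq_0_iff:
  fixes v w :: "bit vec"
  assumes "v \<in> carrier_vec n" "w \<in> carrier_vec n"
  shows "v + w = 0\<^sub>v n \<longleftrightarrow> v = w"
proof
  assume eq: "v + w = 0\<^sub>v n"
  show "v = w"
  proof (rule eq_vecI)
    fix i assume i: "i < dim_vec w"
    then have "v $ i + w $ i = (v + w) $ i" by simp
    also have "\<dots> = 0" using i assms by (simp only: eq) simp
    finally show "v $ i = w $ i" by (simp only: bit_add_eq_0_iff)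
  qed (use assms in simp)
qed (use assms in simp)

subsection \<open>Character sums over binary words\<close>

text \<open>The nontrivial additive character of the two-element field, sending a to (-1)^a.\<close>

definition bit_char :: "bit \<Rightarrow> real" where
  "bit_char a = (if a = 0 then 1 else - 1)"

lemma bit_char_simps [simp]: "bit_char 0 = 1" "bit_char 1 = - 1"
  by (simp_all add: bit_char_def)

lemma bit_char_add: "bit_char (a + b) = bit_char a * bit_char b"
  by (cases a; cases b) (auto simp: bit_char_def)

lemma sum_eq_0_if_sign_reversing:
  fixes g :: "'a \<Rightarrow> real"
  assumes "\<And>x. x \<in> B \<Longrightarrow> \<phi> x \<in> B" and "\<And>x. x \<in> B \<Longrightarrow> \<phi> (\<phi> x) = x"
    and "\<And>x. x \<in> B \<Longrightarrow> g (\<phi> x) = - g x"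
  shows "sum g B = 0"
proof -
  have "sum g B = (\<Sum>x\<in>B. g (\<phi> x))"
    by (rule sum.reindex_bij_witness[of _ \<phi> \<phi>]) (use assms in auto)
  also have "\<dots> = - sum g B"
    using assms(3) by (simp add: sum_negf)
  finally show ?thesis by simp
qed

text \<open>The inputs compatible with an observation in which \<open>y\<close> was sent and the
  positions in \<open>E\<close> were erased.\<close>

definition word_cube :: "nat \<Rightarrow> nat set \<Rightarrow> bit vec \<Rightarrow> bit vec set" where
  "word_cube n E y = {x \<in> carrier_vec n. \<forall>i<n. i \<notin> E \<longrightarrow> x $ i = y $ i}"

lemma word_cube_subset: "word_cube n E y \<subseteq> carrier_vec n"
  by (auto simp: word_cube_def)

lemma finite_word_cube [simp]: "finite (word_cube n E y)"
  using word_cube_subset finite_carrier_vec_bit by (rule finite_subset)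

lemma word_cube_UNIV: "word_cube n UNIV y = carrier_vec n"
  by (auto simp: word_cube_def)

text \<open>Flipping coordinate \<open>i\<close> is an involution of the cube because
  \<open>i\<close> lies in \<open>E\<close>, and it reverses the sign of the character because
  \<open>u\<close> is 1 there.\<close>

lemma sum_bit_char_cube_eq_0:
  assumes u: "u \<in> carrier_vec n" and i: "i < n" "i \<in> E" "u $ i = 1"
  shows "(\<Sum>x\<in>word_cube n E y. bit_char (u \<bullet> x)) = 0"
proof (rule sum_eq_0_if_sign_reversing[where \<phi> = "\<lambda>x. unit_vec n i + x"])
  fix x assume x: "x \<in> word_cube n E y"
  then have xc: "x \<in> carrier_vec n" by (simp add: word_cube_def)
  show "unit_vec n i + x \<in> word_cube n E y"
    using x i by (auto simp: word_cube_def)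
  show "unit_vec n i + (unit_vec n i + x) = x"
    using xc by (intro eq_vecI) (auto simp: add.assoc[symmetric])
  have "u \<bullet> (unit_vec n i + x) = 1 + u \<bullet> x"
    using u xc i by (simp add: scalar_prod_add_distrib[of _ n])
  then show "bit_char (u \<bullet> (unit_vec n i + x)) = - bit_char (u \<bullet> x)"
    by (simp add: bit_char_add)
qed

text \<open>Orthogonality of characters: a nonzero \<open>t\<close> has a coordinate equal to 1, and
  the whole space is the cube with \<open>E = UNIV\<close>.\<close>

lemma sum_bit_char_words:
  assumes t: "t \<in> carrier_vec k"
  shows "(\<Sum>m\<in>carrier_vec k. bit_char (m \<bullet> t)) = (if t = 0\<^sub>v k then 2 ^ k else 0)"
proof (cases "t = 0\<^sub>v k")
  case True
  then show ?thesis by simp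
next
  case False
  then obtain i where i: "i < k" "t $ i = 1"
    using t by (metis bit_not_zero_iff carrier_vecD eq_vecI index_zero_vec(1) index_zero_vec(2))
  have "(\<Sum>m\<in>carrier_vec k. bit_char (m \<bullet> t)) = (\<Sum>m\<in>word_cube k UNIV t. bit_char (t \<bullet> m))"
    unfolding word_cube_UNIV
    by (intro sum.cong refl) (use t in \<open>simp add: comm_scalar_prod\<close>)
  also have "\<dots> = 0"
    by (rule sum_bit_char_cube_eq_0[OF t]) (use i in auto)
  finally show ?thesis using False by simp
qed

text \<open>Equivalently, the columns of \<open>M\<close> with index in \<open>E\<close> do not span
  the space of words of length \<open>dim_row M\<close>. The property passes from \<open>E\<close>
  to its subsets.\<close>

definition ambiguous :: "bit mat \<Rightarrow> nat set \<Rightarrow> bool" where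
  "ambiguous M E \<longleftrightarrow> (\<exists>m \<in> carrier_vec (dim_row M). m \<noteq> 0\<^sub>v (dim_row M) \<and>
     (\<forall>i<dim_col M. i \<in> E \<longrightarrow> (M\<^sup>T *\<^sub>v m) $ i = 0))"

text \<open>By orthogonality, 2^k times the indicator of \<open>M *\<^sub>v x = s\<close> is a sum
  of characters over all \<open>m\<close>; the sum \<open>M *\<^sub>v x + s\<close> serves as the
  difference. After exchanging the sums, each nonzero \<open>m\<close> contributes a character sum
  of its codeword over the cube. It vanishes, since that codeword is 1 somewhere in
  \<open>E\<close>. Only \<open>m = 0\<close> remains and counts the cube.\<close>

lemma card_fibre_word_cube:
  assumes M: "M \<in> carrier_mat k n" and good: "\<not> ambiguous M E" and s: "s \<in> carrier_vec k"
  shows "card {x \<in> word_cube n E y. M *\<^sub>v x = s} * 2 ^ k = card (word_cube n E y)"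
proof -
  let ?B = "word_cube n E y"
  have Mx: "M *\<^sub>v x \<in> carrier_vec k" if "x \<in> ?B" for x
    using M that by (auto simp: word_cube_def)
  have *: "bit_char (m \<bullet> (M *\<^sub>v x + s)) = bit_char (m \<bullet> s) * bit_char ((M\<^sup>T *\<^sub>v m) \<bullet> x)"
    if m: "m \<in> carrier_vec k" and x: "x \<in> ?B" for m x
  proof -
    have "m \<bullet> (M *\<^sub>v x + s) = (M\<^sup>T *\<^sub>v m) \<bullet> x + m \<bullet> s"
      using m x s M Mx[OF x] word_cube_subset[of n E y]
      by (subst scalar_prod_add_distrib[of _ k]) (auto simp: transpose_vec_mult_scalar[of M k n])
    then show ?thesis by (simp only: bit_char_add mult.commute)
  qed
  have zero: "(\<Sum>x\<in>?B. bit_char ((M\<^sup>T *\<^sub>v m) \<bullet> x)) = 0"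
    if m: "m \<in> carrier_vec k" "m \<noteq> 0\<^sub>v k" for m
  proof -
    have dims: "dim_row M = k" "dim_col M = n" using M by auto
    obtain i where "i < n" "i \<in> E" "(M\<^sup>T *\<^sub>v m) $ i \<noteq> 0"
      using good m unfolding ambiguous_def dims by blast
    then have "i < n" "i \<in> E" "(M\<^sup>T *\<^sub>v m) $ i = 1"
      by (simp_all only: bit_not_zero_iff)
    then show ?thesis
      by (intro sum_bit_char_cube_eq_0[where i = i]) (use M that in auto)
  qed
  have "real (card {x \<in> ?B. M *\<^sub>v x = s} * 2 ^ k) = (\<Sum>x\<in>?B. if M *\<^sub>v x = s then 2 ^ k else 0)"
    by (simp add: sum.If_cases Int_def)
  also have "\<dots> = (\<Sum>x\<in>?B. \<Sum>m\<in>carrier_vec k. bit_char (m \<bullet> (M *\<^sub>v x + s)))"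
  proof (intro sum.cong refl)
    fix x assume "x \<in> ?B"
    then have c: "M *\<^sub>v x \<in> carrier_vec k" by (rule Mx)
    then have "M *\<^sub>v x + s = 0\<^sub>v k \<longleftrightarrow> M *\<^sub>v x = s"
      using s by (rule vec_bit_add_eq_0_iff)
    then show "(if M *\<^sub>v x = s then 2 ^ k else 0) =
        (\<Sum>m\<in>carrier_vec k. bit_char (m \<bullet> (M *\<^sub>v x + s)))"
      using c s by (subst sum_bit_char_words) auto
  qed
  also have "\<dots> = (\<Sum>m\<in>carrier_vec k. \<Sum>x\<in>?B. bit_char (m \<bullet> s) * bit_char ((M\<^sup>T *\<^sub>v m) \<bullet> x))"
    by (subst sum.swap) (intro sum.cong refl *)
  also have "\<dots> = (\<Sum>m\<in>carrier_vec k. if m = (0\<^sub>v k :: bit vec) then real (card ?B) else 0)"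
  proof (intro sum.cong refl)
    fix m :: "bit vec" assume m: "m \<in> carrier_vec k"
    have "(\<Sum>x\<in>?B. bit_char ((M\<^sup>T *\<^sub>v 0\<^sub>v k) \<bullet> x)) = (\<Sum>x\<in>?B. 1)"
    proof (intro sum.cong refl)
      fix x assume "x \<in> ?B"
      then have "x \<in> carrier_vec n" by (simp add: word_cube_def)
      moreover have "M\<^sup>T *\<^sub>v 0\<^sub>v k = 0\<^sub>v n"
        using M by (intro eq_vecI) (auto simp: scalar_prod_def)
      ultimately show "bit_char ((M\<^sup>T *\<^sub>v 0\<^sub>v k) \<bullet> x) = 1" by simp
    qed
    then show "(\<Sum>x\<in>?B. bit_char (m \<bullet> s) * bit_char ((M\<^sup>T *\<^sub>v m) \<bullet> x)) =
        (if m = 0\<^sub>v k then real (card ?B) else 0)"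
      using zero[OF m] s by (auto simp: sum_distrib_left[symmetric])
  qed
  also have "\<dots> = real (card ?B)"
    by simp
  finally show ?thesis
    by (simp only: of_nat_eq_iff)
qed

subsection \<open>Random linear codes\<close>

definition weight :: "bit vec \<Rightarrow> nat" where
  "weight u = card {i. i < dim_vec u \<and> u $ i = 1}"

text \<open>The weight enumerator of the full space: each of the n coordinates contributes a factor
  1 + d, and expanding the product yields one term per word.\<close>

lemma sum_power_weight:
  fixes d :: real
  shows "(\<Sum>u\<in>carrier_vec n. d ^ weight u) = (1 + d) ^ n"
proof -
  have "(1 + d) ^ n = (\<Prod>i<n. \<Sum>a\<in>(UNIV :: bit set). if a = 1 then d else 1)"
    by (simp add: UNIV_bit)
  also have "\<dots> = (\<Sum>u\<in>Pi\<^sub>E {..<n} (\<lambda>_. UNIV). \<Prod>i<n. if u i = (1 :: bit) then d else 1)"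
    by (rule prod_sum_PiE) auto
  also have "\<dots> = (\<Sum>u\<in>Pi\<^sub>E {..<n} (\<lambda>_. UNIV). d ^ weight (vec n u))"
  proof (intro sum.cong refl)
    fix u :: "nat \<Rightarrow> bit"
    have "(\<Prod>i<n. if u i = 1 then d else 1) = d ^ card {i \<in> {..<n}. u i = 1}"
      by (simp add: prod.If_cases Int_def)
    also have "{i \<in> {..<n}. u i = 1} = {i. i < dim_vec (vec n u) \<and> vec n u $ i = 1}"
      by auto
    finally show "(\<Prod>i<n. if u i = 1 then d else 1) = d ^ weight (vec n u)"
      by (simp only: weight_def)
  qed
  also have "\<dots> = (\<Sum>u\<in>carrier_vec n. d ^ weight u)"
    using sum.reindex_bij_betw[OF bij_betw_vec_PiE[of n "UNIV :: bit set"], of "\<lambda>u. d ^ weight u"]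
    by simp
  finally show ?thesis by simp
qed

text \<open>For a uniformly random matrix the codeword of a fixed nonzero message is uniform. The
  law of the codeword is invariant under every translation by a word, since the translation can be
  absorbed into the matrix.\<close>

lemma sum_over_matrices:
  fixes g :: "bit vec \<Rightarrow> real"
  assumes m: "m \<in> carrier_vec k" "m \<noteq> 0\<^sub>v k"
  shows "2 ^ n * (\<Sum>M\<in>carrier_mat k n. g (M\<^sup>T *\<^sub>v m)) =
    real (card (carrier_mat k n :: bit mat set)) * (\<Sum>u\<in>carrier_vec n. g u)"
proof -
  obtain i where i: "i < k" "m $ i = 1"
    using m by (metis bit_not_zero_iff carrier_vecD eq_vecI index_zero_vec(1) index_zero_vec(2))
  \<comment> \<open>\<open>A u\<close> has \<open>u\<close> as row \<open>i\<close> and zeros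
    elsewhere; as \<open>m\<close> is 1 at \<open>i\<close>, its transpose sends \<open>m\<close> to
    \<open>u\<close>.\<close>
  define A :: "bit vec \<Rightarrow> bit mat" where "A u = mat k n (\<lambda>(r, c). if r = i then u $ c else 0)" for u
  have Ac: "A u \<in> carrier_mat k n" for u by (simp add: A_def)
  have Am: "(A u)\<^sup>T *\<^sub>v m = u" if "u \<in> carrier_vec n" for u
  proof (rule eq_vecI)
    fix c assume "c < dim_vec u"
    then have c: "c < n" using that by simp
    have "((A u)\<^sup>T *\<^sub>v m) $ c = (\<Sum>r<k. (if r = i then u $ c else 0) * m $ r)"
      using c m by (simp add: A_def scalar_prod_def atLeast0LessThan)
    also have "\<dots> = (\<Sum>r<k. if r = i then u $ c * m $ i else 0)"
      by (intro sum.cong) auto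
    also have "\<dots> = u $ c"
      using i by simp
    finally show "((A u)\<^sup>T *\<^sub>v m) $ c = u $ c" .
  qed (use that in \<open>simp add: A_def\<close>)
  have shift: "(\<Sum>M\<in>carrier_mat k n. g (M\<^sup>T *\<^sub>v m)) = (\<Sum>M\<in>carrier_mat k n. g (M\<^sup>T *\<^sub>v m + u))"
    if u: "u \<in> carrier_vec n" for u
  proof (rule sum.reindex_bij_witness[where i = "\<lambda>M. M + A u" and j = "\<lambda>M. M + A u"])
    fix M :: "bit mat" assume M: "M \<in> carrier_mat k n"
    then show "M + A u \<in> carrier_mat k n" "M + A u \<in> carrier_mat k n"
      using Ac by auto
    show id: "M + A u + A u = M" "M + A u + A u = M"
      using M Ac[of u] by (auto intro!: eq_matI simp: add.assoc simp del: add_bit_eq_xor)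
    have "(M + A u)\<^sup>T *\<^sub>v m + u = (M\<^sup>T *\<^sub>v m + (A u)\<^sup>T *\<^sub>v m) + u"
      using M Ac[of u] m by (simp add: transpose_add[of _ k n] add_mult_distrib_mat_vec[of _ n k])
    also have "\<dots> = M\<^sup>T *\<^sub>v m + (u + u)"
      using M m u by (simp only: Am) (rule assoc_add_vec[of _ n], auto)
    also have "\<dots> = M\<^sup>T *\<^sub>v m"
      using M m u by simp
    finally show "g ((M + A u)\<^sup>T *\<^sub>v m + u) = g (M\<^sup>T *\<^sub>v m)" by simp
  qed
  \<comment> \<open>The factor 2^n is spent on averaging over all shifts \<open>u\<close>; after
    exchanging the sums, the inner sum runs over all words whatever \<open>M\<close> is.\<close>
  have "2 ^ n * (\<Sum>M\<in>carrier_mat k n. g (M\<^sup>T *\<^sub>v m)) =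
      (\<Sum>u\<in>carrier_vec n. \<Sum>M\<in>carrier_mat k n. g (M\<^sup>T *\<^sub>v m + u))"
    by (simp add: shift[symmetric])
  also have "\<dots> = (\<Sum>M\<in>carrier_mat k n. \<Sum>u\<in>carrier_vec n. g (M\<^sup>T *\<^sub>v m + u))"
    by (rule sum.swap)
  also have "\<dots> = (\<Sum>M\<in>(carrier_mat k n :: bit mat set). \<Sum>u\<in>carrier_vec n. g u)"
  proof (rule sum.cong[OF refl])
    fix M :: "bit mat" assume M: "M \<in> carrier_mat k n"
    let ?v = "M\<^sup>T *\<^sub>v m"
    have v: "?v \<in> carrier_vec n" using M m by auto
    have inv: "?v + (?v + u) = u" if "u \<in> carrier_vec n" for u
      using v that by (subst assoc_add_vec[symmetric, of _ n]) auto
    show "(\<Sum>u\<in>carrier_vec n. g (?v + u)) = (\<Sum>u\<in>carrier_vec n. g u)"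
      by (rule sum.reindex_bij_witness[where i = "\<lambda>u. ?v + u" and j = "\<lambda>u. ?v + u"])
        (use v inv in auto)
  qed
  finally show ?thesis by simp
qed

text \<open>A first moment argument: in the average over all matrices each of the fewer than 2^k
  nonzero messages contributes ((1 + d) / 2)^n, so not every matrix can exceed the bound.\<close>

lemma exists_matrix_weight_sum_le:
  fixes d :: real
  assumes d: "0 \<le> d"
  shows "\<exists>M\<in>carrier_mat k n.
    (\<Sum>m\<in>carrier_vec k - {0\<^sub>v k}. d ^ weight (M\<^sup>T *\<^sub>v m)) \<le> 2 ^ k * ((1 + d) / 2) ^ n"
proof (rule ccontr)
  assume "\<not> ?thesis"
  then have less: "2 ^ k * ((1 + d) / 2) ^ n < (\<Sum>m\<in>carrier_vec k - {0\<^sub>v k}. d ^ weight (M\<^sup>T *\<^sub>v m))"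
    if "M \<in> carrier_mat k n" for M
    using that by force
  let ?A = "carrier_mat k n :: bit mat set"
  have pos: "card ?A > 0" by (simp add: card_gt_0_iff)
  have "real (card ?A) * (2 ^ k * ((1 + d) / 2) ^ n) = (\<Sum>M\<in>?A. 2 ^ k * ((1 + d) / 2) ^ n)"
    by simp
  also have "\<dots> < (\<Sum>M\<in>?A. \<Sum>m\<in>carrier_vec k - {0\<^sub>v k}. d ^ weight (M\<^sup>T *\<^sub>v m))"
    by (intro sum_strict_mono less) auto
  also have "\<dots> = (\<Sum>m\<in>carrier_vec k - {0\<^sub>v k}. \<Sum>M\<in>?A. d ^ weight (M\<^sup>T *\<^sub>v m))"
    by (rule sum.swap)
  also have "\<dots> = (\<Sum>m\<in>carrier_vec k - {0\<^sub>v k :: bit vec}. real (card ?A) * ((1 + d) / 2) ^ n)"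
  proof (intro sum.cong refl)
    fix m :: "bit vec" assume "m \<in> carrier_vec k - {0\<^sub>v k}"
    then have "2 ^ n * (\<Sum>M\<in>?A. d ^ weight (M\<^sup>T *\<^sub>v m)) = real (card ?A) * (1 + d) ^ n"
      using sum_over_matrices[of m k n "\<lambda>u. d ^ weight u"] by (simp add: sum_power_weight)
    then show "(\<Sum>M\<in>?A. d ^ weight (M\<^sup>T *\<^sub>v m)) = real (card ?A) * ((1 + d) / 2) ^ n"
      by (simp add: field_simps power_divide)
  qed
  also have "\<dots> \<le> real (card ?A) * (2 ^ k * ((1 + d) / 2) ^ n)"
  proof -
    have "real (card (carrier_vec k - {0\<^sub>v k :: bit vec})) \<le> 2 ^ k"
      using card_mono[of "carrier_vec k :: bit vec set" "carrier_vec k - {0\<^sub>v k}"]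
      by (metis Diff_subset card_carrier_vec_bit finite_carrier_vec_bit of_nat_le_iff of_nat_numeral of_nat_power)
    then show ?thesis
      using d by (simp add: mult.left_commute mult_left_mono mult_right_mono)
  qed
  finally show False by simp
qed

text \<open>Factor x^\<theta> as x times x^(\<theta> - 1) and bound each of the second factors by
  the corresponding power of the full sum. This is the subadditivity of the power 1/\<theta> in
  inverted form.\<close>

lemma sum_powr_le:
  fixes b :: "'a \<Rightarrow> real"
  assumes b: "\<And>i. i \<in> I \<Longrightarrow> 0 \<le> b i" and \<theta>: "1 \<le> \<theta>"
  shows "(\<Sum>i\<in>I. b i powr \<theta>) \<le> (\<Sum>i\<in>I. b i) powr \<theta>"
proof (cases "finite I")
  case True
  let ?B = "\<Sum>i\<in>I. b i"
  have B: "0 \<le> ?B" using b by (rule sum_nonneg)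
  have eq: "x powr \<theta> = x * x powr (\<theta> - 1)" if "0 \<le> x" for x :: real
    using that by (cases "x = 0") (auto simp: powr_diff)
  have "(\<Sum>i\<in>I. b i powr \<theta>) \<le> (\<Sum>i\<in>I. b i * ?B powr (\<theta> - 1))"
  proof (rule sum_mono)
    fix i assume i: "i \<in> I"
    have "b i \<le> ?B"
      using i True b by (intro member_le_sum) auto
    then have "b i powr (\<theta> - 1) \<le> ?B powr (\<theta> - 1)"
      using b[OF i] \<theta> by (intro powr_mono2) auto
    then show "b i powr \<theta> \<le> b i * ?B powr (\<theta> - 1)"
      using b[OF i] by (simp add: eq mult_left_mono)
  qed
  also have "\<dots> = ?B powr \<theta>"
    using B by (simp add: eq sum_distrib_right[symmetric])
  finally show ?thesis .
qed simp

text \<open>The outer natural power matters: \<open>\<delta> powr (w / \<theta>)\<close> would be \<open>0\<close> rather than \<open>1\<close> at \<open>\<delta> = 0\<close>, \<open>w = 0\<close>.\<close>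

lemma powr_inverse_power_powr:
  fixes \<delta> \<theta> :: real
  assumes "0 \<le> \<delta>" "\<theta> \<noteq> 0"
  shows "((\<delta> powr (1 / \<theta>)) ^ w) powr \<theta> = \<delta> ^ w"
proof (induction w)
  case (Suc w)
  then show ?case using assms by (simp add: powr_mult powr_powr)
qed simp

subsection \<open>Maximum likelihood decoding over the erasure channel\<close>

text \<open>Separates the noise from the input: the erased positions are drawn without reference to
  the transmitted word, and \<open>erase\<close> then applies them.\<close>

definition erasure_set :: "nat \<Rightarrow> real \<Rightarrow> nat set pmf" where
  "erasure_set n \<delta> = map_pmf (\<lambda>e. {i. i < n \<and> e i}) (Pi_pmf {..<n} False (\<lambda>_. bernoulli_pmf \<delta>))"

definition erase :: "bit vec \<Rightarrow> nat set \<Rightarrow> bit option vec" where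
  "erase x E = vec (dim_vec x) (\<lambda>i. if i \<in> E then None else Some (x $ i))"

lemma set_erasure_set: "set_pmf (erasure_set n \<delta>) \<subseteq> Pow {..<n}"
  by (auto simp: erasure_set_def)

text \<open>A received word reveals exactly its erased positions and the symbols at the
  others.\<close>

lemma erase_eq_iff:
  assumes "x \<in> carrier_vec n" "y \<in> carrier_vec n" "E \<subseteq> {..<n}" "F \<subseteq> {..<n}"
  shows "erase x E = erase y F \<longleftrightarrow> E = F \<and> x \<in> word_cube n F y"
proof -
  have "erase x E = erase y F \<longleftrightarrow>
      (\<forall>i<n. (if i \<in> E then None else Some (x $ i)) = (if i \<in> F then None else Some (y $ i)))"
    using assms(1,2) by (auto simp: erase_def vec_eq_iff)
  also have "\<dots> \<longleftrightarrow> (\<forall>i<n. (i \<in> E \<longleftrightarrow> i \<in> F) \<and> (i \<notin> F \<longrightarrow> x $ i = y $ i))"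
    by (intro all_cong) auto
  also have "\<dots> \<longleftrightarrow> E = F \<and> x \<in> word_cube n F y"
    using assms by (auto simp: word_cube_def)
  finally show ?thesis .
qed

text \<open>The erasure bits are pulled out of the product law with \<open>Pi_pmf_bind\<close>.
  Default values concern only indices beyond the word, which \<open>vec\<close> discards.\<close>

lemma bec_word_eq: "bec_word \<delta> x = map_pmf (erase x) (erasure_set (dim_vec x) \<delta>)"
proof -
  let ?A = "{..<dim_vec x}"
  have "Pi_pmf ?A undefined (\<lambda>i. bec \<delta> (x $ i)) =
      Pi_pmf ?A undefined (\<lambda>i. bind_pmf (bernoulli_pmf \<delta>) (\<lambda>e. return_pmf (if e then None else Some (x $ i))))"
    by (simp add: bec_def map_pmf_def)
  also have "\<dots> = bind_pmf (Pi_pmf ?A False (\<lambda>_. bernoulli_pmf \<delta>))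
      (\<lambda>e. Pi_pmf ?A undefined (\<lambda>i. return_pmf (if e i then None else Some (x $ i))))"
    by (rule Pi_pmf_bind) simp
  also have "\<dots> = map_pmf (\<lambda>e i. if i \<in> ?A then if e i then None else Some (x $ i) else undefined)
      (Pi_pmf ?A False (\<lambda>_. bernoulli_pmf \<delta>))"
    by (simp add: map_pmf_def)
  finally show ?thesis
    by (auto simp: bec_word_def erasure_set_def erase_def map_pmf_comp vec_eq_iff intro!: map_pmf_cong)
qed

text \<open>Pulling first the input bits and then the erasure bits out of the product exhibits a
  uniform word and an independent erasure set.\<close>

lemma iid_pair_bec_joint:
  "iid_pair n (bec_joint \<epsilon>) =
     map_pmf (\<lambda>(x, E). (x, erase x E)) (pair_pmf (pmf_of_set (carrier_vec n)) (erasure_set n \<epsilon>))"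
proof -
  let ?A = "{..<n}"
  let ?e = "Pi_pmf ?A False (\<lambda>_. bernoulli_pmf \<epsilon>)"
  have *: "map_pmf (vec n) (Pi_pmf ?A 0 (\<lambda>_. pmf_of_set {0, 1 :: bit})) = pmf_of_set (carrier_vec n)"
  proof -
    have eq: "Pi_pmf ?A (0 :: bit) (\<lambda>_. pmf_of_set {0, 1}) = pmf_of_set (PiE_dflt ?A 0 (\<lambda>_. UNIV))"
      by (simp add: Pi_pmf_of_set UNIV_bit)
    \<comment> \<open>Functions in this set take the default value 0 outside \<open>{..<n}\<close>,
      so \<open>vec n\<close> loses nothing.\<close>
    have inj: "inj_on (vec n) (PiE_dflt ?A (0 :: bit) (\<lambda>_. UNIV))"
    proof (rule inj_onI)
      fix f g :: "nat \<Rightarrow> bit"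
      assume fg: "f \<in> PiE_dflt ?A 0 (\<lambda>_. UNIV)" "g \<in> PiE_dflt ?A 0 (\<lambda>_. UNIV)" "vec n f = vec n g"
      show "f = g"
      proof
        fix i show "f i = g i"
        proof (cases "i < n")
          case True
          then have "f i = vec n f $ i" "vec n g $ i = g i" by simp_all
          then show ?thesis by (simp only: fg(3))
        qed (use fg(1,2) in \<open>simp add: PiE_dflt_def\<close>)
      qed
    qed
    have img: "vec n ` PiE_dflt ?A (0 :: bit) (\<lambda>_. UNIV) = carrier_vec n"
    proof (intro equalityI subsetI)
      fix v :: "bit vec" assume v: "v \<in> carrier_vec n"
      have "v = vec n (\<lambda>i. if i < n then v $ i else 0)"
        by (rule eq_vecI) (use v in auto)
      moreover have "(\<lambda>i. if i < n then v $ i else 0) \<in> PiE_dflt ?A (0 :: bit) (\<lambda>_. UNIV)"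
        by (auto simp: PiE_dflt_def)
      ultimately show "v \<in> vec n ` PiE_dflt ?A (0 :: bit) (\<lambda>_. UNIV)" by blast
    qed auto
    have "finite (PiE_dflt ?A (0 :: bit) (\<lambda>_. UNIV))" by auto
    then show ?thesis
      unfolding eq by (subst map_pmf_of_set_inj[OF inj]) (auto simp: img)
  qed
  have "Pi_pmf ?A undefined (\<lambda>_. bec_joint \<epsilon>) = Pi_pmf ?A undefined (\<lambda>_. bind_pmf (pmf_of_set {0, 1})
      (\<lambda>x. bind_pmf (bernoulli_pmf \<epsilon>) (\<lambda>e. return_pmf (x, if e then None else Some x))))"
    by (simp add: bec_joint_def bec_def map_pmf_def bind_assoc_pmf bind_return_pmf)
  also have "\<dots> = bind_pmf (Pi_pmf ?A 0 (\<lambda>_. pmf_of_set {0, 1})) (\<lambda>x. Pi_pmf ?A undefined (\<lambda>i.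
      bind_pmf (bernoulli_pmf \<epsilon>) (\<lambda>e. return_pmf (x i, if e then None else Some (x i)))))"
    by (rule Pi_pmf_bind) simp
  also have "\<dots> = bind_pmf (Pi_pmf ?A 0 (\<lambda>_. pmf_of_set {0, 1})) (\<lambda>x. bind_pmf ?e (\<lambda>e.
      Pi_pmf ?A undefined (\<lambda>i. return_pmf (x i, if e i then None else Some (x i)))))"
    by (intro bind_pmf_cong refl Pi_pmf_bind) simp
  finally have "iid_pair n (bec_joint \<epsilon>) = bind_pmf (Pi_pmf ?A 0 (\<lambda>_. pmf_of_set {0, 1})) (\<lambda>x.
      bind_pmf ?e (\<lambda>e. return_pmf (vec n x, erase (vec n x) {i. i < n \<and> e i})))"
    by (auto simp: iid_pair_def map_bind_pmf erase_def vec_eq_iff intro!: bind_pmf_cong)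
  also have "\<dots> = bind_pmf (map_pmf (vec n) (Pi_pmf ?A 0 (\<lambda>_. pmf_of_set {0, 1}))) (\<lambda>x.
      bind_pmf ?e (\<lambda>e. return_pmf (x, erase x {i. i < n \<and> e i})))"
    by (simp add: bind_map_pmf)
  finally show ?thesis
    by (simp add: * erasure_set_def pair_pmf_def bind_map_pmf map_bind_pmf)
qed

lemma bernoulli_pmf_complement:
  assumes "0 \<le> \<epsilon>" "\<epsilon> \<le> 1"
  shows "map_pmf Not (bernoulli_pmf (1 - \<epsilon>)) = bernoulli_pmf \<epsilon>"
proof (rule pmf_eqI)
  fix b
  \<comment> \<open>The double negation exhibits \<open>b\<close> as a value of \<open>Not\<close>,
    as the rule for injective images requires.\<close>
  have "pmf (map_pmf Not (bernoulli_pmf (1 - \<epsilon>))) (\<not> (\<not> b)) = pmf (bernoulli_pmf (1 - \<epsilon>)) (\<not> b)"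
    by (rule pmf_map_inj') (auto intro: injI)
  then show "pmf (map_pmf Not (bernoulli_pmf (1 - \<epsilon>))) b = pmf (bernoulli_pmf \<epsilon>) b"
    using assms by (cases b) auto
qed

text \<open>The bridge between the two channels: what the decoder sees has the law of what the
  eavesdropper misses.\<close>

lemma erasure_set_complement:
  assumes "0 \<le> \<epsilon>" "\<epsilon> \<le> 1"
  shows "map_pmf (\<lambda>E. {..<n} - E) (erasure_set n (1 - \<epsilon>)) = erasure_set n \<epsilon>"
proof -
  let ?A = "{..<n}"
  have "Pi_pmf ?A True (\<lambda>_. bernoulli_pmf \<epsilon>) =
      map_pmf (\<lambda>h. Not \<circ> h) (Pi_pmf ?A False (\<lambda>_. bernoulli_pmf (1 - \<epsilon>)))"
    unfolding bernoulli_pmf_complement[OF assms, symmetric] by (rule Pi_pmf_map) auto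
  \<comment> \<open>Negating the bits also turns the default \<open>False\<close> into
    \<open>True\<close>, so the default has to be switched back.\<close>
  then have "Pi_pmf ?A False (\<lambda>_. bernoulli_pmf \<epsilon>) = map_pmf (\<lambda>f x. if x \<in> ?A then f x else False)
      (map_pmf (\<lambda>h. Not \<circ> h) (Pi_pmf ?A False (\<lambda>_. bernoulli_pmf (1 - \<epsilon>))))"
    using Pi_pmf_default_swap[of ?A False True "\<lambda>_. bernoulli_pmf \<epsilon>"] by simp
  then show ?thesis
    by (auto simp: erasure_set_def map_pmf_comp intro!: map_pmf_cong)
qed

text \<open>The event asks that every position of \<open>S\<close> below \<open>n\<close> be erased;
  independence gives one factor \<delta> for each of them.\<close>

lemma prob_erasure_set_superset:
  assumes "0 \<le> \<delta>" "\<delta> \<le> 1"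
  shows "measure_pmf.prob (erasure_set n \<delta>) {E. \<forall>i<n. i \<notin> E \<longrightarrow> i \<notin> S} = \<delta> ^ card {i. i < n \<and> i \<in> S}"
proof -
  have "(\<lambda>e. {i. i < n \<and> e i}) -` {E. \<forall>i<n. i \<notin> E \<longrightarrow> i \<notin> S} =
      Pi {..<n} (\<lambda>i. if i \<in> S then {True} else UNIV)"
    by (auto simp: Pi_def split: if_splits)
  then have "measure_pmf.prob (erasure_set n \<delta>) {E. \<forall>i<n. i \<notin> E \<longrightarrow> i \<notin> S} =
      measure_pmf.prob (Pi_pmf {..<n} False (\<lambda>_. bernoulli_pmf \<delta>)) (Pi {..<n} (\<lambda>i. if i \<in> S then {True} else UNIV))"
    by (simp add: erasure_set_def)
  also have "\<dots> = (\<Prod>i<n. measure_pmf.prob (bernoulli_pmf \<delta>) (if i \<in> S then {True} else UNIV))"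
    by (rule measure_Pi_pmf_Pi) simp
  also have "\<dots> = (\<Prod>i<n. if i \<in> S then \<delta> else 1)"
    using assms by (intro prod.cong) (auto simp: measure_pmf_single)
  also have "\<dots> = \<delta> ^ card ({..<n} \<inter> S)"
    by (simp add: prod.If_cases)
  also have "{..<n} \<inter> S = {i. i < n \<and> i \<in> S}" by auto
  finally show ?thesis .
qed

text \<open>Only the pattern \<open>E\<close> can produce this received word, and only from an input
  that agrees with \<open>x\<close> off \<open>E\<close>. Hence the likelihood takes a single value
  on all compatible inputs and is 0 on the others.\<close>

lemma pmf_bec_word_erase:
  assumes "c \<in> carrier_vec n" "x \<in> carrier_vec n" "E \<in> set_pmf (erasure_set n \<delta>)"
  shows "pmf (bec_word \<delta> c) (erase x E) = (if c \<in> word_cube n E x then pmf (erasure_set n \<delta>) E else 0)"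
proof -
  have E: "E \<subseteq> {..<n}" using assms(3) set_erasure_set by blast
  have "pmf (bec_word \<delta> c) (erase x E) = measure_pmf.prob (erasure_set n \<delta>) (erase c -` {erase x E})"
    using assms(1) by (simp add: bec_word_eq pmf_map)
  also have "\<dots> = measure_pmf.prob (erasure_set n \<delta>) (if c \<in> word_cube n E x then {E} else {})"
  proof (rule measure_prob_cong_0)
    fix F assume "F \<in> erase c -` {erase x E} - (if c \<in> word_cube n E x then {E} else {})"
    then show "pmf (erasure_set n \<delta>) F = 0"
      using erase_eq_iff[OF assms(1,2), of F E] E set_erasure_set[of n \<delta>]
      by (cases "F \<subseteq> {..<n}") (auto simp: set_pmf_iff split: if_splits)
  next
    fix F assume "F \<in> (if c \<in> word_cube n E x then {E} else {}) - erase c -` {erase x E}"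
    then show "pmf (erasure_set n \<delta>) F = 0"
      using erase_eq_iff[OF assms(1,2), of E E] E by (auto split: if_splits)
  qed
  finally show ?thesis by (simp add: measure_pmf_single)
qed

lemma ml_messages_erase:
  assumes M: "M \<in> carrier_mat k n" and m: "m \<in> carrier_vec k" and E: "E \<in> set_pmf (erasure_set n \<delta>)"
  shows "ml_messages M \<delta> (erase (M\<^sup>T *\<^sub>v m) E) =
    {m' \<in> carrier_vec k. M\<^sup>T *\<^sub>v m' \<in> word_cube n E (M\<^sup>T *\<^sub>v m)}"
proof -
  let ?L = "\<lambda>m'. pmf (bec_word \<delta> (M\<^sup>T *\<^sub>v m')) (erase (M\<^sup>T *\<^sub>v m) E)"
  have c: "M\<^sup>T *\<^sub>v m' \<in> carrier_vec n" if "m' \<in> carrier_vec k" for m' using M that by auto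
  have k: "dim_row M = k" using M by simp
  have L: "?L m' = (if M\<^sup>T *\<^sub>v m' \<in> word_cube n E (M\<^sup>T *\<^sub>v m) then pmf (erasure_set n \<delta>) E else 0)"
    if "m' \<in> carrier_vec k" for m'
    using c m that E by (intro pmf_bec_word_erase) auto
  \<comment> \<open>Positivity separates compatible from incompatible messages; with likelihood 0
    all messages would tie.\<close>
  have pos: "0 < pmf (erasure_set n \<delta>) E" using E by (simp add: pmf_positive)
  have self: "M\<^sup>T *\<^sub>v m \<in> word_cube n E (M\<^sup>T *\<^sub>v m)" using c[OF m] by (simp add: word_cube_def)
  show ?thesis
    unfolding ml_messages_def is_arg_max_def k
  proof (intro Collect_cong conj_cong refl)
    fix m' :: "bit vec" assume m': "m' \<in> carrier_vec k"
    show "(\<nexists>y. y \<in> carrier_vec k \<and> ?L m' < ?L y) \<longleftrightarrow> M\<^sup>T *\<^sub>v m' \<in> word_cube n E (M\<^sup>T *\<^sub>v m)"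
    proof
      assume "\<nexists>y. y \<in> carrier_vec k \<and> ?L m' < ?L y"
      then have "\<not> ?L m' < ?L m" using m by blast
      then show "M\<^sup>T *\<^sub>v m' \<in> word_cube n E (M\<^sup>T *\<^sub>v m)"
        using L[OF m] L[OF m'] self pos by (auto split: if_splits)
    next
      assume "M\<^sup>T *\<^sub>v m' \<in> word_cube n E (M\<^sup>T *\<^sub>v m)"
      then show "\<nexists>y. y \<in> carrier_vec k \<and> ?L m' < ?L y"
        using L L[OF m'] pos by (auto split: if_splits)
    qed
  qed
qed

text \<open>A competitor \<open>m'\<close> is compatible exactly when the codeword of
  \<open>m' + m\<close> vanishes on the unerased positions, and \<open>m' + m\<close> is nonzero
  exactly when \<open>m'\<close> differs from \<open>m\<close>.\<close>

lemma ml_messages_erase_unique_iff: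
  assumes M: "M \<in> carrier_mat k n" and m: "m \<in> carrier_vec k" and E: "E \<in> set_pmf (erasure_set n \<delta>)"
  shows "ml_messages M \<delta> (erase (M\<^sup>T *\<^sub>v m) E) \<noteq> {m} \<longleftrightarrow> ambiguous M ({..<n} - E)"
proof -
  have c: "M\<^sup>T *\<^sub>v m' \<in> carrier_vec n" if "m' \<in> carrier_vec k" for m' using M that by auto
  have dims: "dim_row M = k" "dim_col M = n" using M by auto
  define Q where "Q v \<longleftrightarrow> (\<forall>i<n. i \<in> {..<n} - E \<longrightarrow> (M\<^sup>T *\<^sub>v v) $ i = 0)" for v
  have cube: "M\<^sup>T *\<^sub>v m' \<in> word_cube n E (M\<^sup>T *\<^sub>v m) \<longleftrightarrow> Q (m' + m)" if m': "m' \<in> carrier_vec k" for m'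
  proof -
    have "(M\<^sup>T *\<^sub>v (m' + m)) $ i = 0 \<longleftrightarrow> (M\<^sup>T *\<^sub>v m') $ i = (M\<^sup>T *\<^sub>v m) $ i" if "i < n" for i
    proof -
      have "(M\<^sup>T *\<^sub>v (m' + m)) $ i = (M\<^sup>T *\<^sub>v m') $ i + (M\<^sup>T *\<^sub>v m) $ i"
        using M m m' that by (subst mult_add_distrib_mat_vec[of _ n k]) auto
      then show ?thesis by (simp only: bit_add_eq_0_iff)
    qed
    then show ?thesis
      using c[OF m'] unfolding word_cube_def Q_def mem_Collect_eq Diff_iff lessThan_iff by blast
  qed
  have self: "M\<^sup>T *\<^sub>v m \<in> word_cube n E (M\<^sup>T *\<^sub>v m)" using c[OF m] by (simp add: word_cube_def)
  have "ml_messages M \<delta> (erase (M\<^sup>T *\<^sub>v m) E) \<noteq> {m} \<longleftrightarrow>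
      (\<exists>m'\<in>carrier_vec k. m' \<noteq> m \<and> M\<^sup>T *\<^sub>v m' \<in> word_cube n E (M\<^sup>T *\<^sub>v m))"
    unfolding ml_messages_erase[OF assms] using m self by blast
  also have "\<dots> \<longleftrightarrow> (\<exists>m'\<in>carrier_vec k. m' + m \<noteq> 0\<^sub>v k \<and> Q (m' + m))"
    by (intro bex_cong refl) (simp only: cube vec_bit_add_eq_0_iff[OF _ m])
  also have "\<dots> \<longleftrightarrow> (\<exists>m'\<in>carrier_vec k. m' \<noteq> 0\<^sub>v k \<and> Q m')"
  proof (intro iffI; elim bexE)
    fix m' assume m': "m' \<in> carrier_vec k" and *: "m' \<noteq> 0\<^sub>v k \<and> Q m'"
    have "(m' + m) + m = m'"
      using m' m by (subst assoc_add_vec[of _ k]) auto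
    then show "\<exists>m'\<in>carrier_vec k. m' + m \<noteq> 0\<^sub>v k \<and> Q (m' + m)"
      using m' m * by (intro bexI[of _ "m' + m"]) simp_all
  next
    fix m' assume m': "m' \<in> carrier_vec k" and *: "m' + m \<noteq> 0\<^sub>v k \<and> Q (m' + m)"
    show "\<exists>m'\<in>carrier_vec k. m' \<noteq> 0\<^sub>v k \<and> Q m'"
      using * add_carrier_vec[OF m' m] by (rule bexI[where x = "m' + m"])
  qed
  also have "\<dots> \<longleftrightarrow> ambiguous M ({..<n} - E)"
    by (simp only: ambiguous_def dims Q_def)
  finally show ?thesis .
qed

text \<open>Given the message, failure is an event about the erasure set that does not mention the
  message, so the average over messages disappears. The laws of the Boolean failure indicator are
  compared.\<close>

lemma ml_error_prob_eq:
  assumes M: "M \<in> carrier_mat k n"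
  shows "ml_error_prob M \<delta> = measure_pmf.prob (erasure_set n \<delta>) {E. ambiguous M ({..<n} - E)}"
proof -
  let ?U = "pmf_of_set (carrier_vec k :: bit vec set)"
  let ?J = "bind_pmf ?U (\<lambda>m. bind_pmf (bec_word \<delta> (M\<^sup>T *\<^sub>v m)) (\<lambda>z. return_pmf (m, z)))"
  have dims: "dim_row M = k" "dim_col M = n" using M by auto
  have "map_pmf (\<lambda>(m, z). ml_messages M \<delta> z \<noteq> {m}) ?J =
      bind_pmf ?U (\<lambda>m. map_pmf (\<lambda>E. ml_messages M \<delta> (erase (M\<^sup>T *\<^sub>v m) E) \<noteq> {m}) (erasure_set n \<delta>))"
    by (simp add: map_bind_pmf bec_word_eq dims map_pmf_def bind_assoc_pmf bind_return_pmf)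
  also have "\<dots> = bind_pmf ?U (\<lambda>m. map_pmf (\<lambda>E. ambiguous M ({..<n} - E)) (erasure_set n \<delta>))"
    using ml_messages_erase_unique_iff[OF M] by (intro bind_pmf_cong map_pmf_cong refl) simp_all
  also have "\<dots> = map_pmf (\<lambda>E. ambiguous M ({..<n} - E)) (erasure_set n \<delta>)"
    by simp
  finally have eq: "map_pmf (\<lambda>(m, z). ml_messages M \<delta> z \<noteq> {m}) ?J =
      map_pmf (\<lambda>E. ambiguous M ({..<n} - E)) (erasure_set n \<delta>)" .
  have "ml_error_prob M \<delta> = measure_pmf.prob (map_pmf (\<lambda>(m, z). ml_messages M \<delta> z \<noteq> {m}) ?J) {True}"
    unfolding ml_error_prob_def dims by (simp add: vimage_def case_prod_unfold)
  also have "\<dots> = measure_pmf.prob (erasure_set n \<delta>) {E. ambiguous M ({..<n} - E)}"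
    unfolding eq by (simp add: vimage_def)
  finally show ?thesis .
qed

lemma ml_error_prob_complement:
  assumes "M \<in> carrier_mat k n" "0 \<le> \<epsilon>" "\<epsilon> \<le> 1"
  shows "ml_error_prob M (1 - \<epsilon>) = measure_pmf.prob (erasure_set n \<epsilon>) {E. ambiguous M E}"
  unfolding ml_error_prob_eq[OF assms(1)] erasure_set_complement[OF assms(2,3), of n, symmetric]
  by (simp add: vimage_def)

text \<open>Union bound over the nonzero messages: each is confusable with zero exactly when all
  ones of its codeword are erased.\<close>

lemma ml_error_prob_le_weight_sum:
  assumes M: "M \<in> carrier_mat k n" and \<delta>: "0 \<le> \<delta>" "\<delta> \<le> 1"
  shows "ml_error_prob M \<delta> \<le> (\<Sum>m\<in>carrier_vec k - {0\<^sub>v k}. \<delta> ^ weight (M\<^sup>T *\<^sub>v m))"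
proof -
  let ?F = "\<lambda>m. {E. \<forall>i<n. i \<notin> E \<longrightarrow> i \<notin> {i. (M\<^sup>T *\<^sub>v m) $ i = 1}}"
  have dims: "dim_row M = k" "dim_col M = n" using M by auto
  have "{E. ambiguous M ({..<n} - E)} = (\<Union>m\<in>carrier_vec k - {0\<^sub>v k}. ?F m)"
    unfolding ambiguous_def dims by auto
  then have "ml_error_prob M \<delta> \<le> (\<Sum>m\<in>carrier_vec k - {0\<^sub>v k}. measure_pmf.prob (erasure_set n \<delta>) (?F m))"
    unfolding ml_error_prob_eq[OF M]
    by (simp only:) (rule measure_pmf.finite_measure_subadditive_finite, auto)
  also have "\<dots> = (\<Sum>m\<in>carrier_vec k - {0\<^sub>v k}. \<delta> ^ weight (M\<^sup>T *\<^sub>v m))"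
    unfolding prob_erasure_set_superset[OF \<delta>] weight_def by (simp add: dims)
  finally show ?thesis .
qed

lemma exists_ml_error_prob_le:
  assumes \<delta>: "0 \<le> \<delta>" "\<delta> \<le> 1"
  shows "\<exists>M\<in>carrier_mat k n. \<forall>\<theta>\<ge>1.
    ml_error_prob M \<delta> \<le> (2 ^ k * ((1 + \<delta> powr (1 / \<theta>)) / 2) ^ n) powr \<theta>"
proof -
  let ?P = "\<lambda>M. ml_error_prob M \<delta>"
  \<comment> \<open>The minimizer is fixed before \<theta>. The matrix \<open>N\<close> obtained
    below depends on \<theta>, and minimality passes its bound on to \<open>M\<close>.\<close>
  define M where "M = arg_min_on ?P (carrier_mat k n)"
  have M: "M \<in> carrier_mat k n"
    unfolding M_def by (rule arg_min_if_finite(1)) simp_all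
  have min: "?P M \<le> ?P N" if "N \<in> carrier_mat k n" for N
    unfolding M_def by (rule arg_min_least) (use that in simp_all)
  have "?P M \<le> (2 ^ k * ((1 + \<delta> powr (1 / \<theta>)) / 2) ^ n) powr \<theta>" if \<theta>: "1 \<le> \<theta>" for \<theta>
  proof -
    let ?d = "\<delta> powr (1 / \<theta>)"
    obtain N where N: "N \<in> carrier_mat k n"
      and le: "(\<Sum>m\<in>carrier_vec k - {0\<^sub>v k}. ?d ^ weight (N\<^sup>T *\<^sub>v m)) \<le> 2 ^ k * ((1 + ?d) / 2) ^ n"
      using exists_matrix_weight_sum_le[of ?d k n] by auto
    have "?P M \<le> (\<Sum>m\<in>carrier_vec k - {0\<^sub>v k}. \<delta> ^ weight (N\<^sup>T *\<^sub>v m))"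
      using min[OF N] ml_error_prob_le_weight_sum[OF N \<delta>] by linarith
    also have "\<dots> = (\<Sum>m\<in>carrier_vec k - {0\<^sub>v k}. (?d ^ weight (N\<^sup>T *\<^sub>v m)) powr \<theta>)"
      using \<delta> \<theta> by (simp add: powr_inverse_power_powr)
    also have "\<dots> \<le> (\<Sum>m\<in>carrier_vec k - {0\<^sub>v k}. ?d ^ weight (N\<^sup>T *\<^sub>v m)) powr \<theta>"
      using \<theta> by (intro sum_powr_le) auto
    also have "\<dots> \<le> (2 ^ k * ((1 + ?d) / 2) ^ n) powr \<theta>"
      using le \<theta> by (intro powr_mono2) (auto intro: sum_nonneg)
    finally show ?thesis .
  qed
  then show ?thesis using M by blast
qed

subsection \<open>Mutual information of finitely supported distributions\<close>

lemma distributed_map_pmf: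
  "distributed (measure_pmf p) (count_space UNIV) X (\<lambda>s. ennreal (pmf (map_pmf X p) s))"
  by (simp add: distributed_def map_pmf_rep_eq[symmetric] measure_pmf_eq_density[symmetric])

text \<open>Countability makes the product of the counting measures a counting measure, so all
  densities are point masses. The integrand vanishes off the support, and base \<open>exp 1\<close>
  turns \<open>log\<close> into \<open>ln\<close>.\<close>

lemma mutual_information_pmf:
  fixes X :: "'a \<Rightarrow> 's" and Z :: "'a \<Rightarrow> 'z"
  assumes count: "countable (UNIV :: 's set)" "countable (UNIV :: 'z set)" and fin: "finite (set_pmf p)"
  defines "q \<equiv> map_pmf (\<lambda>w. (X w, Z w)) p"
  shows "prob_space.mutual_information (measure_pmf p) (exp 1) (count_space UNIV) (count_space UNIV) X Z =
    (\<Sum>(s, z)\<in>set_pmf q. pmf q (s, z) * ln (pmf q (s, z) / (pmf (map_pmf fst q) s * pmf (map_pmf snd q) z)))"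
proof -
  have info: "information_space (measure_pmf p) (exp 1)"
    by unfold_locales simp
  have pair: "count_space UNIV \<Otimes>\<^sub>M count_space UNIV = (count_space UNIV :: ('s \<times> 'z) measure)"
    using pair_measure_countable[OF count] by simp
  have marg: "map_pmf fst q = map_pmf X p" "map_pmf snd q = map_pmf Z p"
    by (simp_all add: q_def map_pmf_comp)
  let ?f = "\<lambda>x. pmf q x * log (exp 1) (pmf q x / (pmf (map_pmf fst q) (fst x) * pmf (map_pmf snd q) (snd x)))"
  have "prob_space.mutual_information (measure_pmf p) (exp 1) (count_space UNIV) (count_space UNIV) X Z =
      integral\<^sup>L (count_space UNIV \<Otimes>\<^sub>M count_space UNIV) ?f"
  proof (rule information_space.mutual_information_distr[OF info])
    show "sigma_finite_measure (count_space (UNIV :: 's set))" "sigma_finite_measure (count_space (UNIV :: 'z set))"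
      using count by (auto intro: sigma_finite_measure_count_space_countable)
  qed (simp_all only: pair marg, simp_all add: distributed_map_pmf q_def)
  also have "\<dots> = (\<integral>x. ?f x \<partial>count_space UNIV)"
    by (simp only: pair)
  also have "\<dots> = (\<Sum>x\<in>set_pmf q. ?f x)"
  proof -
    have supp: "{x. ?f x \<noteq> 0} \<subseteq> set_pmf q" by (auto simp: set_pmf_iff)
    have fin': "finite (set_pmf q)" using fin by (simp add: q_def)
    have "(\<integral>x. ?f x \<partial>count_space UNIV) = (\<Sum>x | x \<in> UNIV \<and> ?f x \<noteq> 0. ?f x)"
      by (rule lebesgue_integral_count_space_finite_support) (use finite_subset[OF supp fin'] in simp)
    also have "\<dots> = (\<Sum>x\<in>set_pmf q. ?f x)"
      by (rule sum.mono_neutral_left[OF fin']) (use supp in auto)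
    finally show ?thesis .
  qed
  finally show ?thesis
    by (simp add: case_prod_beta log_def)
qed

text \<open>A function of the joint law alone, meant for finite support; restricting the sum to the
  support drops the 0 ln 0 terms.\<close>

definition mutual_information_of :: "('s \<times> 'z) pmf \<Rightarrow> real" where
  "mutual_information_of q =
    (\<Sum>(s, z)\<in>set_pmf q. pmf q (s, z) * ln (pmf q (s, z) / (pmf (map_pmf fst q) s * pmf (map_pmf snd q) z)))"

lemma pmf_le_pmf_map: "pmf q x \<le> pmf (map_pmf f q) (f x)"
  unfolding pmf_map by (simp add: pmf.rep_eq measure_pmf.finite_measure_mono)

text \<open>Gibbs' inequality, from ln t \<ge> 1 - 1/t applied to the ratio of the joint law to the
  product of its marginals.\<close>

lemma mutual_information_of_nonneg:
  assumes fin: "finite (set_pmf q)"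
  shows "0 \<le> mutual_information_of q"
proof -
  let ?r = "\<lambda>(s, z). pmf (map_pmf fst q) s * pmf (map_pmf snd q) z"
  have pos: "0 < pmf q x" "0 < ?r x" if "x \<in> set_pmf q" for x
    using that pmf_le_pmf_map[of q x fst] pmf_le_pmf_map[of q x snd]
    by (auto simp: case_prod_beta pmf_positive intro: order.strict_trans2)
  \<comment> \<open>The support lies in the product of the marginal supports, on which the product
    law has total mass 1.\<close>
  have "sum ?r (set_pmf q) \<le> sum ?r (fst ` set_pmf q \<times> snd ` set_pmf q)"
    using fin by (intro sum_mono2) (auto simp: case_prod_beta intro: rev_image_eqI)
  also have "\<dots> = (\<Sum>s\<in>set_pmf (map_pmf fst q). pmf (map_pmf fst q) s) * (\<Sum>z\<in>set_pmf (map_pmf snd q). pmf (map_pmf snd q) z)"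
    by (simp add: sum_product sum.cartesian_product)
  also have "\<dots> = 1"
    using fin by (simp add: sum_pmf_eq_1)
  finally have "0 \<le> (\<Sum>x\<in>set_pmf q. pmf q x) - sum ?r (set_pmf q)"
    using fin by (simp add: sum_pmf_eq_1)
  also have "\<dots> = (\<Sum>x\<in>set_pmf q. pmf q x * (1 - ?r x / pmf q x))"
    unfolding sum_subtractf[symmetric]
    by (intro sum.cong refl) (use pos in \<open>fastforce simp: field_simps\<close>)
  also have "\<dots> \<le> (\<Sum>x\<in>set_pmf q. pmf q x * ln (pmf q x / ?r x))"
  proof (intro sum_mono mult_left_mono)
    fix x assume x: "x \<in> set_pmf q"
    have "- ln (pmf q x / ?r x) = ln (?r x / pmf q x)"
      using pos[OF x] by (simp add: ln_div)
    also have "\<dots> \<le> ?r x / pmf q x - 1"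
      using pos[OF x] by (intro ln_le_minus_one) simp
    finally show "1 - ?r x / pmf q x \<le> ln (pmf q x / ?r x)" by simp
  qed simp
  finally show ?thesis by (simp add: mutual_information_of_def case_prod_beta)
qed

lemma mutual_information_of_relabel:
  assumes inj: "inj_on g (fst ` set_pmf q)"
  shows "mutual_information_of (map_pmf (apfst g) q) = mutual_information_of q"
proof -
  have inj': "inj_on (apfst g) (set_pmf q)"
    using inj by (fastforce simp: inj_on_def)
  have joint: "pmf (map_pmf (apfst g) q) (g s, z) = pmf q (s, z)" if "(s, z) \<in> set_pmf q" for s z
    using pmf_map_inj[OF inj' that] by simp
  have fst: "pmf (map_pmf fst (map_pmf (apfst g) q)) (g s) = pmf (map_pmf fst q) s" if "(s, z) \<in> set_pmf q" for s z
  proof -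
    have "map_pmf fst (map_pmf (apfst g) q) = map_pmf g (map_pmf fst q)"
      by (simp add: map_pmf_comp)
    moreover have "s \<in> set_pmf (map_pmf fst q)" using that by force
    ultimately show ?thesis using inj by (simp add: pmf_map_inj)
  qed
  have snd: "map_pmf snd (map_pmf (apfst g) q) = map_pmf snd q"
    by (simp add: map_pmf_comp)
  show ?thesis
    unfolding mutual_information_of_def set_map_pmf sum.reindex[OF inj'] snd
    by (intro sum.cong refl) (auto simp: joint fst)
qed

text \<open>Where \<open>z\<close> is outside \<open>B\<close> the logarithm is ln 1. Elsewhere the
  joint mass is at most the marginal mass of \<open>z\<close>, so the ratio is at most 1/c, and the
  joint masses with \<open>z\<close> in \<open>B\<close> add up to the probability of
  \<open>B\<close>.\<close>

lemma mutual_information_of_le: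
  assumes fin: "finite (set_pmf q)" and c: "0 < c"
    and marginal: "\<And>s z. (s, z) \<in> set_pmf q \<Longrightarrow> c \<le> pmf (map_pmf fst q) s"
    and indep: "\<And>s z. (s, z) \<in> set_pmf q \<Longrightarrow> z \<notin> B \<Longrightarrow>
      pmf q (s, z) = pmf (map_pmf fst q) s * pmf (map_pmf snd q) z"
  shows "mutual_information_of q \<le> - ln c * measure_pmf.prob (map_pmf snd q) B"
proof -
  have "mutual_information_of q \<le> (\<Sum>x\<in>set_pmf q. if snd x \<in> B then pmf q x * - ln c else 0)"
    unfolding mutual_information_of_def
  proof (intro sum_mono)
    fix x assume x: "x \<in> set_pmf q"
    obtain s z where [simp]: "x = (s, z)" by (cases x)
    have p: "0 < pmf q (s, z)" using x by (simp add: pmf_positive)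
    have pz: "pmf q (s, z) \<le> pmf (map_pmf snd q) z"
      using pmf_le_pmf_map[of q "(s, z)" snd] by simp
    have ps: "c \<le> pmf (map_pmf fst q) s" using marginal x by simp
    have le: "ln (pmf q (s, z) / (pmf (map_pmf fst q) s * pmf (map_pmf snd q) z)) \<le> - ln c"
    proof -
      have "pmf q (s, z) * c \<le> pmf (map_pmf snd q) z * pmf (map_pmf fst q) s"
        using pz ps p c by (intro mult_mono) auto
      then have "pmf q (s, z) / (pmf (map_pmf fst q) s * pmf (map_pmf snd q) z) \<le> 1 / c"
        using p pz ps c by (simp add: field_simps)
      then have "ln (pmf q (s, z) / (pmf (map_pmf fst q) s * pmf (map_pmf snd q) z)) \<le> ln (1 / c)"
        using p pz ps c by (subst ln_le_cancel_iff) auto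
      then show ?thesis using c by (simp add: ln_div)
    qed
    have eq: "ln (pmf q (s, z) / (pmf (map_pmf fst q) s * pmf (map_pmf snd q) z)) = 0" if "z \<notin> B"
      using indep[of s z] x that p by simp
    show "(case x of (s, z) \<Rightarrow> pmf q (s, z) * ln (pmf q (s, z) / (pmf (map_pmf fst q) s * pmf (map_pmf snd q) z)))
        \<le> (if snd x \<in> B then pmf q x * - ln c else 0)"
      using mult_left_mono[OF le less_imp_le[OF p]] eq by (cases "z \<in> B") simp_all
  qed
  also have "\<dots> = (\<Sum>x\<in>{x \<in> set_pmf q. snd x \<in> B}. pmf q x) * - ln c"
    using fin by (simp add: sum.If_cases sum_distrib_right Int_def sum_negf)
  also have "(\<Sum>x\<in>{x \<in> set_pmf q. snd x \<in> B}. pmf q x) = measure_pmf.prob q {x \<in> set_pmf q. snd x \<in> B}"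
    using fin by (simp add: measure_measure_pmf_finite)
  also have "\<dots> = measure_pmf.prob q (snd -` B)"
    by (rule measure_prob_cong_0) (auto simp: set_pmf_iff)
  finally show ?thesis by (simp add: mult.commute)
qed

lemma finite_set_iid_pair: "finite (set_pmf P) \<Longrightarrow> finite (set_pmf (iid_pair n P))"
  by (simp add: iid_pair_def set_Pi_pmf finite_PiE_dflt)

lemma leaked_information_eq:
  fixes f :: "'x vec \<Rightarrow> 's" and P :: "('x \<times> 'z) pmf"
  assumes "countable (UNIV :: 's set)" "countable (UNIV :: 'z set)" "finite (set_pmf P)"
  shows "leaked_information P n f = mutual_information_of (map_pmf (apfst f) (iid_pair n P))"
proof -
  have "map_pmf (\<lambda>w. ((\<lambda>(x, z). f x) w, (\<lambda>(x, z). z) w)) (iid_pair n P) = map_pmf (apfst f) (iid_pair n P)"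
    by (intro map_pmf_cong refl) auto
  then show ?thesis
    unfolding leaked_information_def mutual_information_of_def
    using mutual_information_pmf[OF assms(1) countable_vec[OF assms(2)] finite_set_iid_pair[OF assms(3)],
        of n "\<lambda>(x, z). f x" "\<lambda>(x, z). z"]
    by simp
qed

subsection \<open>Leaked information of linear functions\<close>

lemma finite_set_bec_joint: "finite (set_pmf (bec_joint \<epsilon>))"
  by (rule finite_subset[of _ "UNIV \<times> UNIV"]) (auto simp: finite_prod)

lemma countable_UNIV_bit_vec: "countable (UNIV :: bit vec set)"
  by (intro countable_vec countable_finite) simp

lemma leaked_information_bec_eq:
  fixes f :: "bit vec \<Rightarrow> 's"
  assumes "countable (UNIV :: 's set)"
  shows "leaked_information (bec_joint \<epsilon>) n f =
    mutual_information_of (map_pmf (apfst f) (iid_pair n (bec_joint \<epsilon>)))"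
  by (intro leaked_information_eq assms countable_UNIV_bit_option finite_set_bec_joint)

lemma leaked_information_bec_nonneg:
  fixes f :: "bit vec \<Rightarrow> 's"
  assumes "countable (UNIV :: 's set)"
  shows "0 \<le> leaked_information (bec_joint \<epsilon>) n f"
  unfolding leaked_information_bec_eq[OF assms]
  by (intro mutual_information_of_nonneg) (simp add: finite_set_iid_pair finite_set_bec_joint)

lemma set_iid_pair_bec_joint:
  assumes "(x, z) \<in> set_pmf (iid_pair n (bec_joint \<epsilon>))"
  obtains E where "x \<in> carrier_vec n" "E \<subseteq> {..<n}" "z = erase x E"
  using assms set_erasure_set[of n \<epsilon>] by (auto simp: iid_pair_bec_joint)

lemma leaked_information_bec_relabel:
  fixes f :: "bit vec \<Rightarrow> 's" and g :: "'s \<Rightarrow> 't"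
  assumes "countable (UNIV :: 's set)" "countable (UNIV :: 't set)" "inj_on g (f ` carrier_vec n)"
  shows "leaked_information (bec_joint \<epsilon>) n (\<lambda>x. g (f x)) = leaked_information (bec_joint \<epsilon>) n f"
proof -
  let ?q = "map_pmf (apfst f) (iid_pair n (bec_joint \<epsilon>))"
  have "map_pmf (apfst (\<lambda>x. g (f x))) (iid_pair n (bec_joint \<epsilon>)) = map_pmf (apfst g) ?q"
    by (auto simp: map_pmf_comp intro!: map_pmf_cong)
  moreover have "fst ` set_pmf ?q \<subseteq> f ` carrier_vec n"
    by (auto elim: set_iid_pair_bec_joint)
  ultimately show ?thesis
    using mutual_information_of_relabel[of g ?q] inj_on_subset[OF assms(3)]
    by (simp add: leaked_information_bec_eq assms(1,2))
qed

text \<open>Up to null pairs the event is a rectangle: compatible words satisfying \<open>Q\<close>,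
  times the single pattern \<open>E\<close>. A trivial \<open>Q\<close> yields the law of the
  observation, and \<open>Q y\<close> as \<open>M *\<^sub>v y = s\<close> yields the joint
  law.\<close>

lemma prob_erase_eq:
  assumes x: "x \<in> carrier_vec n" and E: "E \<subseteq> {..<n}"
  shows "measure_pmf.prob (pair_pmf (pmf_of_set (carrier_vec n)) (erasure_set n \<epsilon>))
      {(y, F). Q y \<and> erase y F = erase x E} =
    real (card {y \<in> word_cube n E x. Q y}) / 2 ^ n * pmf (erasure_set n \<epsilon>) E"
proof -
  let ?U = "pmf_of_set (carrier_vec n :: bit vec set)" and ?C = "{y \<in> word_cube n E x. Q y}"
  have C: "?C \<subseteq> carrier_vec n" using word_cube_subset by auto
  then have finC: "finite ?C" using finite_carrier_vec_bit by (rule finite_subset)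
  have supp: "y \<in> carrier_vec n \<and> F \<subseteq> {..<n}" if "(y, F) \<in> set_pmf (pair_pmf ?U (erasure_set n \<epsilon>))" for y F
    using that set_erasure_set[of n \<epsilon>] by auto
  have "measure_pmf.prob (pair_pmf ?U (erasure_set n \<epsilon>)) {(y, F). Q y \<and> erase y F = erase x E} =
      measure_pmf.prob (pair_pmf ?U (erasure_set n \<epsilon>)) (?C \<times> {E})"
  proof (rule measure_prob_cong_0)
    fix w assume w: "w \<in> {(y, F). Q y \<and> erase y F = erase x E} - ?C \<times> {E}"
    obtain y F where [simp]: "w = (y, F)" by (cases w)
    have "w \<notin> set_pmf (pair_pmf ?U (erasure_set n \<epsilon>))"
      using w supp[of y F] erase_eq_iff[of y n x F E] x E by auto
    then show "pmf (pair_pmf ?U (erasure_set n \<epsilon>)) w = 0" by (simp only: set_pmf_iff not_not)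
  next
    fix w assume w: "w \<in> ?C \<times> {E} - {(y, F). Q y \<and> erase y F = erase x E}"
    then show "pmf (pair_pmf ?U (erasure_set n \<epsilon>)) w = 0"
      using erase_eq_iff[of "fst w" n x E E] x E C by auto
  qed
  also have "\<dots> = measure_pmf.prob ?U ?C * measure_pmf.prob (erasure_set n \<epsilon>) {E}"
    by (rule measure_pmf_prob_product) (use finC in \<open>auto intro: countable_finite\<close>)
  also have "measure_pmf.prob ?U ?C = real (card ?C) / 2 ^ n"
    using C by (simp add: measure_pmf_of_set Int_absorb1)
  finally show ?thesis by (simp add: measure_pmf_single)
qed

lemma leaked_information_le_ml_error_prob:
  assumes M: "M \<in> carrier_mat k n" and \<epsilon>: "0 \<le> \<epsilon>" "\<epsilon> \<le> 1"
  shows "leaked_information (bec_joint \<epsilon>) n (\<lambda>x. M *\<^sub>v x) \<le> real n * ln 2 * ml_error_prob M (1 - \<epsilon>)"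
proof -
  let ?U = "pmf_of_set (carrier_vec n :: bit vec set)"
  let ?D = "pair_pmf ?U (erasure_set n \<epsilon>)"
  let ?q = "map_pmf (apfst (\<lambda>x. M *\<^sub>v x)) (iid_pair n (bec_joint \<epsilon>))"
  \<comment> \<open>The observations that may leak; the erased set is read off the received word as
    the positions of \<open>None\<close>.\<close>
  define B where "B = {z :: bit option vec. ambiguous M {i. i < n \<and> z $ i = None}}"
  have q: "?q = map_pmf (\<lambda>(x, E). (M *\<^sub>v x, erase x E)) ?D"
    by (simp add: iid_pair_bec_joint map_pmf_comp case_prod_unfold)
  have q1: "map_pmf fst ?q = map_pmf (\<lambda>x. M *\<^sub>v x) (map_pmf fst ?D)"
    unfolding q by (simp add: map_pmf_comp case_prod_beta del: map_fst_pair_pmf)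
  have q2: "map_pmf snd ?q = map_pmf (\<lambda>(x, E). erase x E) ?D"
    unfolding q by (simp add: map_pmf_comp case_prod_unfold)
  have p1: "pmf (map_pmf fst ?q) s = real (card {x \<in> carrier_vec n. M *\<^sub>v x = s}) / 2 ^ n" for s
    unfolding q1 map_fst_pair_pmf by (simp add: pmf_map measure_pmf_of_set Int_def vimage_def)
  have p2: "pmf (map_pmf snd ?q) (erase x E) = real (card (word_cube n E x)) / 2 ^ n * pmf (erasure_set n \<epsilon>) E"
    if "x \<in> carrier_vec n" "E \<subseteq> {..<n}" for x E
  proof -
    have "(\<lambda>(x, E). erase x E) -` {erase x E} = {(y, F). True \<and> erase y F = erase x E}" by auto
    then show ?thesis
      unfolding q2 pmf_map using prob_erase_eq[OF that, where Q = "\<lambda>_. True"] by simp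
  qed
  have p12: "pmf ?q (s, erase x E) =
      real (card {y \<in> word_cube n E x. M *\<^sub>v y = s}) / 2 ^ n * pmf (erasure_set n \<epsilon>) E"
    if "x \<in> carrier_vec n" "E \<subseteq> {..<n}" for x E s
  proof -
    have "(\<lambda>(x, E). (M *\<^sub>v x, erase x E)) -` {(s, erase x E)} = {(y, F). M *\<^sub>v y = s \<and> erase y F = erase x E}"
      by auto
    then show ?thesis
      unfolding q pmf_map using prob_erase_eq[OF that, where Q = "\<lambda>y. M *\<^sub>v y = s"] by simp
  qed
  have none: "{i. i < n \<and> erase x E $ i = None} = E" if "x \<in> carrier_vec n" "E \<subseteq> {..<n}" for x E
    using that by (auto simp: erase_def split: if_splits)
  have supp: "\<exists>x E. x \<in> carrier_vec n \<and> E \<subseteq> {..<n} \<and> s = M *\<^sub>v x \<and> z = erase x E"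
    if "(s, z) \<in> set_pmf ?q" for s z
    using that set_erasure_set[of n \<epsilon>] unfolding q by auto
  \<comment> \<open>The constant 1/2^n is a lower bound because every attained value has a preimage
    among the 2^n equally likely words; it produces the factor n ln 2.\<close>
  have "mutual_information_of ?q \<le> - ln (1 / 2 ^ n) * measure_pmf.prob (map_pmf snd ?q) B"
  proof (rule mutual_information_of_le)
    show "finite (set_pmf ?q)"
      by (simp add: finite_set_iid_pair finite_set_bec_joint)
  next
    fix s z assume "(s, z) \<in> set_pmf ?q"
    then obtain x where "x \<in> carrier_vec n" "s = M *\<^sub>v x"
      using supp by blast
    then have "card {y \<in> carrier_vec n. M *\<^sub>v y = s} > 0"
      by (auto simp: card_gt_0_iff)
    then show "1 / 2 ^ n \<le> pmf (map_pmf fst ?q) s"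
      unfolding p1 by (intro divide_right_mono) simp_all
  next
    fix s z assume "(s, z) \<in> set_pmf ?q" and z: "z \<notin> B"
    then obtain x E where x: "x \<in> carrier_vec n" and E: "E \<subseteq> {..<n}" and s: "s = M *\<^sub>v x" and zE: "z = erase x E"
      using supp by blast
    have sc: "s \<in> carrier_vec k" using M x s by auto
    have good: "\<not> ambiguous M E"
      using z none[OF x E] by (simp add: B_def zE)
    \<comment> \<open>Enlarging the set preserves non-ambiguity, so the value is uniform without
      conditioning as well, and conditioning on the observation leaves its law unchanged.\<close>
    then have good': "\<not> ambiguous M UNIV"
      by (auto simp: ambiguous_def)
    have cube: "real (card (word_cube n E x)) = real (card {y \<in> word_cube n E x. M *\<^sub>v y = s}) * 2 ^ k"
      using arg_cong[OF card_fibre_word_cube[OF M good sc, of x], of real] by simp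
    have "real (card {y \<in> carrier_vec n. M *\<^sub>v y = s}) * 2 ^ k = 2 ^ n"
      using arg_cong[OF card_fibre_word_cube[OF M good' sc, of x], of real] by (simp add: word_cube_UNIV)
    then have fibre: "real (card {y \<in> carrier_vec n. M *\<^sub>v y = s}) = 2 ^ n / 2 ^ k"
      by (simp add: field_simps)
    show "pmf ?q (s, z) = pmf (map_pmf fst ?q) s * pmf (map_pmf snd ?q) z"
      unfolding zE p1 p2[OF x E] p12[OF x E] cube fibre by simp
  qed simp
  also have "measure_pmf.prob (map_pmf snd ?q) B = measure_pmf.prob ?D {w. ambiguous M (snd w)}"
    unfolding q2 measure_map_pmf
  proof (rule measure_pmf.finite_measure_eq_AE)
    show "AE w in ?D. w \<in> (\<lambda>(x, E). erase x E) -` B \<longleftrightarrow> w \<in> {w. ambiguous M (snd w)}"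
      unfolding AE_measure_pmf_iff
    proof safe
      fix x E assume "(x, E) \<in> set_pmf ?D"
      then have "x \<in> carrier_vec n" "E \<subseteq> {..<n}" using set_erasure_set[of n \<epsilon>] by auto
      from none[OF this] show "ambiguous M (snd (x, E))" if "erase x E \<in> B"
        using that by (simp add: B_def)
      from none[OF \<open>x \<in> carrier_vec n\<close> \<open>E \<subseteq> {..<n}\<close>] show "(x, E) \<in> (\<lambda>(x, E). erase x E) -` B"
        if "ambiguous M (snd (x, E))"
        using that by (simp add: B_def)
    qed
  qed simp_all
  also have "\<dots> = measure_pmf.prob (map_pmf snd ?D) {E. ambiguous M E}"
    unfolding measure_map_pmf by (simp add: vimage_def)
  also have "\<dots> = ml_error_prob M (1 - \<epsilon>)"
    unfolding map_snd_pair_pmf ml_error_prob_complement[OF M \<epsilon>] ..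
  finally show ?thesis
    by (simp add: leaked_information_bec_eq countable_UNIV_bit_vec ln_div ln_realpow)
qed

subsection \<open>Exponents\<close>

text \<open>A factor linear in n costs ln(n c)/n, which tends to 0; adding a sequence with a finite
  limit commutes with the limit inferior.\<close>

lemma exponent_le_if_le_linear:
  assumes a: "\<And>n. 0 \<le> a n" and b: "\<And>n. 0 \<le> b n" and ab: "\<And>n. a n \<le> real n * c * b n" and c: "0 < c"
  shows "exponent b \<le> exponent a"
proof -
  have "(\<lambda>n. - ln (real n * c) / real n) \<longlonglongrightarrow> 0"
    using c by real_asymp
  then have lim: "(\<lambda>n. ereal (- ln (real n * c) / real n)) \<longlonglongrightarrow> ereal 0"
    by (simp only: lim_ereal)
  have "exponent b = ereal 0 + exponent b" by simp
  also have "\<dots> = liminf (\<lambda>n. ereal (- ln (real n * c) / real n) + ereal (1 / real n) * neg_log (b n))"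
    unfolding exponent_def by (rule ereal_liminf_lim_add[symmetric, OF lim]) simp
  also have "\<dots> \<le> exponent a"
    unfolding exponent_def
  proof (rule Liminf_mono, rule eventually_sequentiallyI[of 1])
    fix n :: nat assume n: "1 \<le> n"
    show "ereal (- ln (real n * c) / real n) + ereal (1 / real n) * neg_log (b n) \<le>
        ereal (1 / real n) * neg_log (a n)"
    \<comment> \<open>For n at least 1 the factor 1/n is positive, so the infinite value of
      \<open>neg_log\<close> at 0 survives the multiplication.\<close>
    proof (cases "a n = 0")
      case True
      then show ?thesis using n by (simp add: neg_log_def)
    next
      case False
      then have pos: "0 < a n" using a[of n] by simp
      then have "b n \<noteq> 0" using ab[of n] by auto
      then have bpos: "0 < b n" using b[of n] by simp
      have "ln (a n) \<le> ln (real n * c * b n)"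
        using pos ab[of n] by simp
      also have "\<dots> = ln (real n * c) + ln (b n)"
        using n c bpos by (subst ln_mult) auto
      finally have "ln (a n) / real n \<le> (ln (real n * c) + ln (b n)) / real n"
        by (rule divide_right_mono) simp
      then have "- ln (real n * c) / real n + 1 / real n * (- ln (b n)) \<le> 1 / real n * (- ln (a n))"
        by (simp add: add_divide_distrib)
      then show ?thesis using pos bpos by (simp add: neg_log_def)
    qed
  qed
  finally show ?thesis .
qed

lemma ml_error_prob_nonneg: "0 \<le> ml_error_prob M \<delta>"
  by (simp add: ml_error_prob_def)

text \<open>Taking logarithms and dividing by n bounds the exponent terms from below by a sequence
  that converges to the stated value.\<close>

lemma exponent_ge_if_le_powr:
  assumes P: "\<And>n. 0 \<le> P n" and D: "0 < D" and \<theta>: "0 < \<theta>"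
    and le: "\<And>n. P n \<le> (2 ^ k n * D ^ n) powr \<theta>"
    and k: "(\<lambda>n. real (k n) / real n * ln 2) \<longlonglongrightarrow> R"
  shows "ereal (\<theta> * (- R - ln D)) \<le> exponent P"
proof -
  have "(\<lambda>n. \<theta> * (- (real (k n) / real n * ln 2) - ln D)) \<longlonglongrightarrow> \<theta> * (- R - ln D)"
    by (intro tendsto_intros k)
  then have "(\<lambda>n. ereal (\<theta> * (- (real (k n) / real n * ln 2) - ln D))) \<longlonglongrightarrow> ereal (\<theta> * (- R - ln D))"
    by (simp only: lim_ereal)
  then have "ereal (\<theta> * (- R - ln D)) = liminf (\<lambda>n. ereal (\<theta> * (- (real (k n) / real n * ln 2) - ln D)))"
    by (intro lim_imp_Liminf[symmetric]) simp_all
  also have "\<dots> \<le> exponent P"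
    unfolding exponent_def
  proof (rule Liminf_mono, rule eventually_sequentiallyI[of 1])
    fix n :: nat assume n: "1 \<le> n"
    show "ereal (\<theta> * (- (real (k n) / real n * ln 2) - ln D)) \<le> ereal (1 / real n) * neg_log (P n)"
    proof (cases "P n = 0")
      case True
      then show ?thesis using n by (simp add: neg_log_def)
    next
      case False
      then have pos: "0 < P n" using P[of n] by simp
      have "ln (P n) \<le> ln ((2 ^ k n * D ^ n) powr \<theta>)"
        using pos le[of n] D by (subst ln_le_cancel_iff) auto
      also have "\<dots> = \<theta> * (real (k n) * ln 2 + real n * ln D)"
        using D by (simp add: ln_powr ln_mult_pos ln_realpow)
      finally have "ln (P n) / real n \<le> \<theta> * (real (k n) * ln 2 + real n * ln D) / real n"
        by (rule divide_right_mono) simp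
      also have "\<dots> = \<theta> * (real (k n) / real n * ln 2 + ln D)"
        using n by (simp add: field_simps)
      finally have "\<theta> * (- (real (k n) / real n * ln 2) - ln D) \<le> 1 / real n * (- ln (P n))"
        by (simp add: algebra_simps)
      then show ?thesis using False by (simp add: neg_log_def)
    qed
  qed
  finally show ?thesis .
qed

section \<open>Choice of the dimensions and matrices, and combination of the exponent bounds\<close>

theorem corollary5:
  fixes \<epsilon> R :: real
  assumes "0 \<le> \<epsilon>" and "\<epsilon> \<le> 1" and "0 \<le> R"
  shows "\<exists>(k :: nat \<Rightarrow> nat) (M :: nat \<Rightarrow> bit mat).
    (\<forall>n. M n \<in> carrier_mat (k n) n) \<and>
    liminf (\<lambda>n. ereal (real (k n) / real n * ln 2)) \<ge> ereal R \<and>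
    privacy_exponent R (bec_joint \<epsilon>)
      \<ge> exponent (\<lambda>n. leaked_information (bec_joint \<epsilon>) n (\<lambda>x. M n *\<^sub>v x)) \<and>
    exponent (\<lambda>n. leaked_information (bec_joint \<epsilon>) n (\<lambda>x. M n *\<^sub>v x))
      \<ge> exponent (\<lambda>n. ml_error_prob (M n) (1 - \<epsilon>)) \<and>
    exponent (\<lambda>n. ml_error_prob (M n) (1 - \<epsilon>)) \<ge> expurgated_exponent R (1 - \<epsilon>)"
proof -
  \<comment> \<open>Rounding up keeps the rate at least \<open>R\<close> for every positive n and
    costs at most 1/n, so the limit is exactly \<open>R\<close>, as the error exponent
    requires.\<close>
  define k where "k n = nat \<lceil>real n * (R / ln 2)\<rceil>" for n
  let ?\<delta> = "1 - \<epsilon>"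
  have "\<forall>n. \<exists>M. M \<in> carrier_mat (k n) n \<and> (\<forall>\<theta>\<ge>1.
      ml_error_prob M ?\<delta> \<le> (2 ^ k n * ((1 + ?\<delta> powr (1 / \<theta>)) / 2) ^ n) powr \<theta>)"
    using exists_ml_error_prob_le[of ?\<delta>] assms by fastforce
  then obtain M where M: "\<And>n. M n \<in> carrier_mat (k n) n" and ml: "\<And>n \<theta>. 1 \<le> \<theta> \<Longrightarrow>
      ml_error_prob (M n) ?\<delta> \<le> (2 ^ k n * ((1 + ?\<delta> powr (1 / \<theta>)) / 2) ^ n) powr \<theta>"
    by metis
  have "(\<lambda>n. real (k n) / real n) \<longlonglongrightarrow> R / ln 2"
  proof (rule tendsto_sandwich)
    have real_k: "real (k n) = of_int \<lceil>real n * (R / ln 2)\<rceil>" for n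
    proof -
      have "0 \<le> real n * (R / ln 2)" using assms(3) by simp
      then show ?thesis unfolding k_def by (intro of_nat_nat) linarith
    qed
    show "\<forall>\<^sub>F n in sequentially. R / ln 2 \<le> real (k n) / real n"
    proof (rule eventually_sequentiallyI[of 1])
      fix n :: nat assume "1 \<le> n"
      then show "R / ln 2 \<le> real (k n) / real n"
        using le_of_int_ceiling[of "real n * (R / ln 2)"] by (simp add: real_k field_simps)
    qed
    show "\<forall>\<^sub>F n in sequentially. real (k n) / real n \<le> R / ln 2 + 1 / real n"
    proof (rule eventually_sequentiallyI[of 1])
      fix n :: nat assume "1 \<le> n"
      then show "real (k n) / real n \<le> R / ln 2 + 1 / real n"
        using of_int_ceiling_le_add_one[of "real n * (R / ln 2)"] by (simp add: real_k field_simps)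
    qed
    show "(\<lambda>n. R / ln 2 + 1 / real n) \<longlonglongrightarrow> R / ln 2"
      by real_asymp
  qed simp
  then have "(\<lambda>n. real (k n) / real n * ln 2) \<longlonglongrightarrow> R / ln 2 * ln 2"
    by (rule tendsto_mult[OF _ tendsto_const])
  then have k: "(\<lambda>n. real (k n) / real n * ln 2) \<longlonglongrightarrow> R" by simp
  then have "(\<lambda>n. ereal (real (k n) / real n * ln 2)) \<longlonglongrightarrow> ereal R"
    by (simp only: lim_ereal)
  then have rate: "liminf (\<lambda>n. ereal (real (k n) / real n * ln 2)) = ereal R"
    by (simp add: lim_imp_Liminf)
  let ?I = "\<lambda>n. leaked_information (bec_joint \<epsilon>) n (\<lambda>x. M n *\<^sub>v x)"
  have 1: "exponent ?I \<le> privacy_exponent R (bec_joint \<epsilon>)"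
  proof -
    \<comment> \<open>The supremum in \<open>privacy_exponent\<close> ranges over functions into
      sets of natural numbers, so the words \<open>M n *\<^sub>v x\<close> are numbered. The number
      of labels is exactly 2^(k n), which gives the rate.\<close>
    have "\<forall>n. \<exists>g. bij_betw g (carrier_vec (k n) :: bit vec set) {0..<(2 :: nat) ^ k n}"
      using ex_bij_betw_finite_nat[OF finite_carrier_vec_bit] by simp
    then obtain g where g: "\<And>n. bij_betw (g n) (carrier_vec (k n) :: bit vec set) {0..<(2 :: nat) ^ k n}"
      by metis
    have Mx: "M n *\<^sub>v x \<in> carrier_vec (k n)" if "x \<in> carrier_vec n" for n x
      using M[of n] that by auto
    have relabel: "?I n = leaked_information (bec_joint \<epsilon>) n (\<lambda>x. g n (M n *\<^sub>v x))" for n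
    proof (rule leaked_information_bec_relabel[symmetric, OF countable_UNIV_bit_vec])
      show "inj_on (g n) ((\<lambda>x. M n *\<^sub>v x) ` carrier_vec n)"
        using g[of n] Mx by (auto simp: bij_betw_def intro: inj_on_subset)
    qed simp
    show ?thesis
      unfolding privacy_exponent_def
    proof (rule Sup_upper, rule CollectI, intro exI conjI allI)
      show "exponent ?I = exponent (\<lambda>n. leaked_information (bec_joint \<epsilon>) n (\<lambda>x. g n (M n *\<^sub>v x)))"
        by (simp only: relabel)
      show "finite {0..<(2 :: nat) ^ k n}" for n by simp
      show "(\<lambda>x. g n (M n *\<^sub>v x)) \<in> carrier_vec n \<rightarrow> {0..<2 ^ k n}" for n
        using bij_betwE[OF g[of n]] Mx by blast
      show "ereal R \<le> liminf (\<lambda>n. ereal (1 / real n * ln (real (card {0..<(2 :: nat) ^ k n}))))"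
        using rate by (simp add: ln_realpow)
    qed
  qed
  have 2: "exponent (\<lambda>n. ml_error_prob (M n) ?\<delta>) \<le> exponent ?I"
    by (rule exponent_le_if_le_linear[where c = "ln 2"])
      (simp_all add: leaked_information_bec_nonneg countable_UNIV_bit_vec ml_error_prob_nonneg
        leaked_information_le_ml_error_prob[OF M] assms)
  have 3: "expurgated_exponent R ?\<delta> \<le> exponent (\<lambda>n. ml_error_prob (M n) ?\<delta>)"
    unfolding expurgated_exponent_def
  proof (rule SUP_least)
    fix \<theta> :: real assume \<theta>: "\<theta> \<in> {1..}"
    \<comment> \<open>The division by 2 comes from averaging over matrices and supplies the term ln
      2 of the exponent.\<close>
    let ?D = "(1 + ?\<delta> powr (1 / \<theta>)) / 2"
    have D: "0 < 1 + ?\<delta> powr (1 / \<theta>)" by (rule add_pos_nonneg) simp_all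
    have "ereal (\<theta> * (- R - ln ?D)) \<le> exponent (\<lambda>n. ml_error_prob (M n) ?\<delta>)"
      by (rule exponent_ge_if_le_powr[OF ml_error_prob_nonneg _ _ ml k]) (use \<theta> D in auto)
    moreover have "- R - ln ?D = ln 2 - R - ln (1 + ?\<delta> powr (1 / \<theta>))"
      using D by (simp add: ln_div)
    ultimately show "ereal (\<theta> * (ln 2 - R - ln (1 + ?\<delta> powr (1 / \<theta>)))) \<le> exponent (\<lambda>n. ml_error_prob (M n) ?\<delta>)"
      by simp
  qed
  show ?thesis
    using M rate 1 2 3 by (intro exI[of _ k] exI[of _ M]) simp
qed

end
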